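(* For the harmonic oscillator $\widehat{H}=-\Delta+|x|^2$ in $L^2(\mathbb{R}^2)$, there exists a sequence of real-valued eigenfunctions $\{u_k,\ k\ge 1\}$ such that $\widehat{H}u_k = \hat{\lambda}(4k)\, u_k$ with $\hat{\lambda}(4k) = 2(4k+1)$, such that $u_k$ has no critical zeros (i.e. it has a regular nodal set), and such that $$\mu(u_k) \sim \frac{(4k)^2}{8}\quad\text{as } k\to\infty .$$
   Context: A critical zero of a function $u$ is a point at which both $u$ and its differential $du$ vanish. The nodal set $N(u)$ of an eigenfunction $u$ is the closure of its zero set $\{u=0\}$, and $\mu(u)$ denotes the number of nodal domains of $u$, i.e. the number of connected components of $\mathbb{R}^2\setminus N(u)$. The eigenvalues of $\widehat H$ are $\hat\lambda(n)=2(n+1)$, $n\in\mathbb{N}$, with multiplicity $n+1$. The notation $a_k\sim b_k$ means $a_k/b_k\to 1$. *)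

theory Defs
  imports "HOL-Analysis.Analysis" "HOL-Library.Landau_Symbols"
begin

definition partial_derivative ::
  "'a::euclidean_space \<Rightarrow> ('a \<Rightarrow> real) \<Rightarrow> 'a \<Rightarrow> real" where
  "partial_derivative b f x = frechet_derivative f (at x) b"

definition twice_cont_differentiable :: "('a::euclidean_space \<Rightarrow> real) \<Rightarrow> bool" where
  "twice_cont_differentiable f \<longleftrightarrow>
     (\<forall>x. f differentiable (at x)) \<and>
     (\<forall>b\<in>Basis. \<forall>x. partial_derivative b f differentiable (at x)) \<and>
     (\<forall>b\<in>Basis. \<forall>c\<in>Basis.
        continuous_on UNIV (partial_derivative c (partial_derivative b f)))"

definition laplacian :: "('a::euclidean_space \<Rightarrow> real) \<Rightarrow> 'a \<Rightarrow> real" where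
  "laplacian f x = (\<Sum>b\<in>Basis. partial_derivative b (partial_derivative b f) x)"

definition harmonic_oscillator :: "(real^2 \<Rightarrow> real) \<Rightarrow> real^2 \<Rightarrow> real" where
  "harmonic_oscillator u x = - laplacian u x + (norm x)\<^sup>2 * u x"

definition square_integrable :: "('a::euclidean_space \<Rightarrow> real) \<Rightarrow> bool" where
  "square_integrable f \<longleftrightarrow>
     f \<in> borel_measurable lborel \<and> integrable lborel (\<lambda>x. (f x)\<^sup>2)"

(* Real eigenfunctions of the self-adjoint operator in L^2(R^2), taken in their classical
   representative: by elliptic regularity every L^2 eigenfunction is smooth and satisfies
   the eigenvalue equation pointwise. *)
definition is_eigenfunction :: "real \<Rightarrow> (real^2 \<Rightarrow> real) \<Rightarrow> bool" where
  "is_eigenfunction ev u \<longleftrightarrow>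
     twice_cont_differentiable u \<and> square_integrable u \<and> (\<exists>x. u x \<noteq> 0) \<and>
     (\<forall>x. harmonic_oscillator u x = ev * u x)"

definition oscillator_eigenvalue :: "nat \<Rightarrow> real" where
  "oscillator_eigenvalue n = 2 * (real n + 1)"

definition critical_zero :: "('a::euclidean_space \<Rightarrow> real) \<Rightarrow> 'a \<Rightarrow> bool" where
  "critical_zero u x \<longleftrightarrow> u x = 0 \<and> (u has_derivative (\<lambda>v. 0)) (at x)"

definition nodal_set :: "('a::euclidean_space \<Rightarrow> real) \<Rightarrow> 'a set" where
  "nodal_set u = closure {x. u x = 0}"

definition nodal_domains :: "('a::euclidean_space \<Rightarrow> real) \<Rightarrow> 'a set set" where
  "nodal_domains u = components (UNIV - nodal_set u)"

(* The value is 0 when there are infinitely many nodal domains; by Courant's theorem this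
   does not happen for eigenfunctions of the harmonic oscillator. *)
definition nodal_count :: "('a::euclidean_space \<Rightarrow> real) \<Rightarrow> nat" where
  "nodal_count u = card (nodal_domains u)"

end

theory Submission
  imports Defs "HOL-Computational_Algebra.Polynomial" "HOL-Probability.Distributions"
    "HOL-Real_Asymp.Real_Asymp"
begin

text \<open>
  Up to the factor \<open>exp (-r\<^sup>2/2)\<close>, with \<open>z = x + i y\<close> and \<open>t = r\<^sup>2\<close>, take
  \<open>u\<^sub>k = L(t) Re(z\<^sup>2\<^sup>k) + \<epsilon> Re(z\<^sup>4\<^sup>k) - \<delta> M(t)\<close> with \<open>0 < \<delta>\<close> much smaller than \<open>\<epsilon>\<close>, itself small, where
  \<open>L\<close> and \<open>M\<close> are the Laguerre polynomials with (degree, parameter) \<open>(k, 2k)\<close> and \<open>(2k, 0)\<close>.  For \<open>\<epsilon> = \<delta> = 0\<close>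
  the nodal set is a grid of \<open>k\<close> circles and \<open>4k\<close> rays.  The \<open>\<epsilon>\<close>-term is negative on all the rays,
  hence opens every crossing in the same direction; the \<open>\<delta>\<close>-term resolves the origin.

  On each circle \<open>u\<^sub>k\<close> is a quadratic polynomial \<open>A + B c + C c\<^sup>2\<close> in \<open>c = cos 2k\<theta>\<close> with \<open>A < 0 < C\<close>.  Therefore
  \<open>u\<^sub>k < 0\<close> retracts onto the rays \<open>c = 0\<close> and then onto the origin, so it is connected, whereas
  \<open>u\<^sub>k > 0\<close> retracts onto the rays \<open>c = 1\<close> and \<open>c = -1\<close>.  There \<open>u\<^sub>k\<close> is a perturbation of
  \<open>t\<^sup>k L(t)\<close> and of \<open>- t\<^sup>k L(t)\<close>, and since \<open>L\<close> has \<open>k\<close> simple positive zeros, an adjacent pair of such rays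
  meets \<open>k + 1\<close> components.  This gives exactly \<open>1 + 2k(k + 1)\<close> nodal domains.  A critical zero
  would have to be a double zero in \<open>t\<close> on one of these rays.
\<close>

section \<open>Laguerre polynomials and their zeros\<close>

text \<open>This is \<open>n!\<close> times the usual Laguerre polynomial with parameter \<open>a\<close>; the recursion comes from
  Rodrigues' formula, being \<open>d/dt (t\<^sup>a\<^sup>+\<^sup>1 e\<^sup>-\<^sup>t q) = t\<^sup>a e\<^sup>-\<^sup>t ((a + 1 - t) q + t q')\<close>.\<close>

fun laguerre :: "nat \<Rightarrow> nat \<Rightarrow> real poly" where
  "laguerre 0 a = 1"
| "laguerre (Suc n) a =
     [:real a + 1, -1:] * laguerre n (Suc a) + [:0, 1:] * pderiv (laguerre n (Suc a))"

text \<open>By induction on \<open>n\<close>, for all \<open>a\<close> at once. The equation for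
  \<open>(n, a + 1)\<close> is what turns the derivative of the recursion into
  \<open>- (n + 1)\<close> times \<open>laguerre n (a + 1)\<close>; with this value of the
  derivative, the equation for \<open>(n + 1, a)\<close> reduces to the recursion itself.\<close>

lemma laguerre_ode:
  "[:0, 1:] * pderiv (pderiv (laguerre n a)) + [:real a + 1, -1:] * pderiv (laguerre n a)
     + smult (real n) (laguerre n a) = 0"
proof -
  have step: "pderiv (laguerre (Suc n) a) = - smult (real (Suc n)) (laguerre n (Suc a))"
    if "[:0, 1:] * pderiv (pderiv (laguerre n (Suc a)))
      + [:real (Suc a) + 1, -1:] * pderiv (laguerre n (Suc a))
      + smult (real n) (laguerre n (Suc a)) = 0" for n a
  proof (rule poly_ext)
    fix t
    have "poly ([:0, 1:] * pderiv (pderiv (laguerre n (Suc a)))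
      + [:real (Suc a) + 1, -1:] * pderiv (laguerre n (Suc a))
      + smult (real n) (laguerre n (Suc a))) t = 0" by (simp only: that poly_0)
    then show "poly (pderiv (laguerre (Suc n) a)) t
        = poly (- smult (real (Suc n)) (laguerre n (Suc a))) t"
      by (simp add: pderiv_add pderiv_mult pderiv_pCons pderiv_minus pderiv_smult algebra_simps
          del: mult_pCons_left)
  qed
  show ?thesis
  proof (induction n arbitrary: a)
    case (Suc n)
    show ?case
      unfolding step[OF Suc]
      by (rule poly_ext)
        (simp add: pderiv_minus pderiv_smult algebra_simps del: mult_pCons_left)
  qed simp
qed

lemma poly_laguerre_ode:
  "t * poly (pderiv (pderiv (laguerre n a))) t
     + (real a + 1 - t) * poly (pderiv (laguerre n a)) t + real n * poly (laguerre n a) t = 0"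
proof -
  have "poly ([:0, 1:] * pderiv (pderiv (laguerre n a)) + [:real a + 1, -1:] * pderiv (laguerre n a)
     + smult (real n) (laguerre n a)) t = 0" by (simp only: laguerre_ode poly_0)
  then show ?thesis by (simp add: algebra_simps)
qed

lemma poly_laguerre_0_pos: "poly (laguerre n a) 0 > 0"
  by (induction n arbitrary: a) auto

lemma degree_laguerre: "degree (laguerre n a) \<le> n"
proof (induction n arbitrary: a)
  case (Suc n)
  have "degree ([:real a + 1, -1:] * laguerre n (Suc a)) \<le> Suc n"
    using degree_mult_le[of "[:real a + 1, -1:]" "laguerre n (Suc a)"] Suc[of "Suc a"] by simp
  moreover have "degree ([:0, 1:] * pderiv (laguerre n (Suc a))) \<le> Suc n"
    using degree_mult_le[of "[:0, 1::real:]" "pderiv (laguerre n (Suc a))"] Suc[of "Suc a"]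
    by (simp add: degree_pderiv)
  ultimately show ?case by (simp add: degree_add_le del: mult_pCons_left)
qed simp

text \<open>With the factor \<open>n!\<close> kept in, the polynomial is exactly a product of
  factors \<open>w i - t\<close>, with no constant in front.\<close>

lemma coeff_laguerre: "coeff (laguerre n a) n = (-1) ^ n"
proof (induction n arbitrary: a)
  case (Suc n)
  have "coeff (laguerre n (Suc a)) (Suc n) = 0"
    using degree_laguerre[of n "Suc a"] by (intro coeff_eq_0) simp
  then show ?case using Suc by (simp add: coeff_pderiv)
qed simp

section \<open>Polynomials with prescribed real zeros and sign changes\<close>

lemma prod_alternating_sign:
  fixes z :: "nat \<Rightarrow> real"
  assumes "i \<le> n" "\<And>j. j < i \<Longrightarrow> z j < t" "\<And>j. i \<le> j \<Longrightarrow> j < n \<Longrightarrow> t < z j"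
  shows "(-1) ^ i * (\<Prod>j<n. (z j - t)) > 0"
proof -
  have "{..<n} = {..<i} \<union> {i..<n}" using assms(1) by auto
  then have "(\<Prod>j<n. (z j - t)) = (\<Prod>j<i. (z j - t)) * (\<Prod>j=i..<n. (z j - t))"
    by (simp add: prod.union_disjoint ivl_disj_int)
  moreover have "(-1) ^ i * (\<Prod>j<i. (z j - t)) = (\<Prod>j<i. (t - z j))"
    by (subst prod.cong[OF refl, of _ "\<lambda>j. t - z j" "\<lambda>j. (-1) * (z j - t)"])
       (simp_all only: prod.distrib prod_constant card_lessThan, simp)
  moreover have "(\<Prod>j<i. (t - z j)) > 0" "(\<Prod>j=i..<n. (z j - t)) > 0"
    using assms by (auto intro!: prod_pos)
  ultimately show ?thesis by (metis mult.assoc mult_pos_pos)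
qed

text \<open>The leading terms of \<open>p\<close> and of the product cancel, so their difference has
  degree below \<open>n\<close> or is zero; it vanishes at \<open>n\<close> distinct points.\<close>

lemma poly_eq_prod_roots:
  fixes p :: "real poly"
  assumes deg: "degree p \<le> n" and lc: "coeff p n = (-1) ^ n"
    and inj: "inj_on w {..<n}" and root: "\<And>i. i < n \<Longrightarrow> poly p (w i) = 0"
  shows "p = (\<Prod>i<n. [:w i, -1:])"
proof -
  have prod_deg: "degree (\<Prod>i<m. [:w i, -1:]) = m \<and> coeff (\<Prod>i<m. [:w i, -1:]) m = (-1) ^ m" for m
  proof (induction m)
    case (Suc m)
    have "(\<Prod>i<m. [:w i, -1:]) \<noteq> 0" by (simp add: prod_zero_iff)
    then have "degree (\<Prod>i<Suc m. [:w i, -1:]) = Suc m"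
      using Suc by (simp add: degree_mult_eq del: mult_pCons_right)
    moreover have "coeff (\<Prod>i<m. [:w i, -1:]) (Suc m) = 0"
      using Suc by (intro coeff_eq_0) simp
    ultimately show ?case using Suc by simp
  qed simp
  define q where "q = p - (\<Prod>i<n. [:w i, -1:])"
  have "coeff q n = 0" "degree q \<le> n"
    using prod_deg[of n] lc deg by (auto simp: q_def intro: degree_diff_le)
  have "q = 0"
  proof (rule ccontr)
    assume "q \<noteq> 0"
    then have "degree q < n" using \<open>coeff q n = 0\<close> \<open>degree q \<le> n\<close>
      by (metis le_neq_implies_less leading_coeff_0_iff)
    moreover have "w ` {..<n} \<subseteq> {x. poly q x = 0}"
      using root by (auto simp: q_def poly_prod)
    then have "n \<le> card {x. poly q x = 0}"
      using card_mono[OF poly_roots_finite[OF \<open>q \<noteq> 0\<close>]] inj by (metis card_image card_lessThan)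
    ultimately show False using card_poly_roots_bound[OF \<open>q \<noteq> 0\<close>] by simp
  qed
  then show ?thesis by (simp add: q_def)
qed

text \<open>The intermediate value theorem gives a zero between any two consecutive sample points,
  and \<open>n\<close> zeros exhaust the degree. The bound \<open>y i < w i\<close> is kept to make
  the Laguerre zeros positive, with \<open>y 0 = 0\<close>.\<close>

lemma alternating_poly_factorization:
  fixes p :: "real poly"
  assumes "degree p \<le> n" "coeff p n = (-1) ^ n"
    and y: "strict_mono_on {..n} y" and alt: "\<And>i. i \<le> n \<Longrightarrow> (-1) ^ i * poly p (y i) > 0"
  obtains w where "p = (\<Prod>i<n. [:w i, -1:])" "strict_mono_on {..<n} w" "\<And>i. i < n \<Longrightarrow> y i < w i"
proof -
  have "\<exists>x. y i < x \<and> x < y (Suc i) \<and> poly p x = 0" if "i < n" for i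
  proof -
    have "y i < y (Suc i)" using that by (intro strict_mono_onD[OF y]) auto
    have "poly p (y i) * poly p (y (Suc i)) < 0"
      using alt[of i] alt[of "Suc i"] that
      by (cases "even i") (simp_all add: mult_less_0_iff)
    then show ?thesis using poly_IVT[OF \<open>y i < y (Suc i)\<close>] by blast
  qed
  then obtain w where w: "\<And>i. i < n \<Longrightarrow> y i < w i \<and> w i < y (Suc i) \<and> poly p (w i) = 0"
    by metis
  have mono: "strict_mono_on {..<n} w"
  proof (rule strict_mono_onI)
    fix i j assume "i \<in> {..<n}" "j \<in> {..<n}" "i < j"
    then have "y (Suc i) \<le> y j"
      by (intro strict_mono_on_leD[OF y]) auto
    then show "w i < w j" using w[of i] w[of j] \<open>i \<in> _\<close> \<open>j \<in> _\<close> by auto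
  qed
  have "p = (\<Prod>i<n. [:w i, -1:])"
    by (rule poly_eq_prod_roots) (use assms w strict_mono_on_imp_inj_on[OF mono] in auto)
  then show thesis using that mono w by blast
qed

lemma poly_pderiv_prod_at_root:
  fixes z :: "nat \<Rightarrow> real"
  assumes "i < n"
  shows "poly (pderiv (\<Prod>j<n. [:z j, -1:])) (z i) = - (\<Prod>j\<in>{..<n} - {i}. (z j - z i))"
proof -
  have "(\<Prod>j<n. [:z j, -1:]) = [:z i, -1:] * (\<Prod>j\<in>{..<n} - {i}. [:z j, -1:])"
    using assms by (intro prod.remove) auto
  then show ?thesis
    by (simp only: pderiv_mult poly_add poly_mult poly_prod) (simp add: pderiv_pCons poly_prod)
qed

text \<open>Interlacing. At a zero \<open>z i\<close> of \<open>q = laguerre n (a + 1)\<close> the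
  recursion gives the value \<open>z i * q'(z i)\<close>, whose sign alternates with
  \<open>i\<close>. Together with the positive value at 0 and the sign \<open>(-1) ^ (n + 1)\<close>
  far out, this makes \<open>n + 2\<close> sample points of alternating sign.\<close>

lemma laguerre_factorization:
  obtains z where "laguerre n a = (\<Prod>i<n. [:z i, -1:])" "strict_mono_on {..<n} z"
    "\<And>i. i < n \<Longrightarrow> z i > 0"
proof -
  have "\<exists>z. laguerre n a = (\<Prod>i<n. [:z i, -1:]) \<and> strict_mono_on {..<n} z \<and> (\<forall>i<n. z i > 0)"
  proof (induction n arbitrary: a)
    case 0
    then show ?case by (auto simp: strict_mono_on_def)
  next
    case (Suc n)
    let ?p = "laguerre (Suc n) a"
    obtain z where z: "laguerre n (Suc a) = (\<Prod>i<n. [:z i, -1:])" "strict_mono_on {..<n} z"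
      "\<forall>i<n. z i > 0" using Suc by blast
    have pz: "(-1) ^ Suc i * poly ?p (z i) > 0" if "i < n" for i
    proof -
      have less: "z j < z j'" if "j < j'" "j' < n" for j j'
        using that by (intro strict_mono_onD[OF z(2)]) auto
      \<comment> \<open>The zeros other than \<open>z i\<close>, renumbered without a gap: the first
        \<open>i\<close> of them lie below \<open>z i\<close> and the rest above.\<close>
      define z' where "z' j = (if j < i then z j else z (Suc j))" for j
      have "(\<Prod>j\<in>{..<n} - {i}. (z j - z i)) = (\<Prod>j<n-1. (z' j - z i))"
        by (rule prod.reindex_bij_witness
              [where i = "\<lambda>j. if j < i then j else Suc j" and j = "\<lambda>j. if j < i then j else j - 1"])
          (use that in \<open>auto simp: z'_def\<close>)
      moreover have "(-1) ^ i * (\<Prod>j<n-1. (z' j - z i)) > 0"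
        by (rule prod_alternating_sign) (use that less in \<open>auto simp: z'_def\<close>)
      moreover have "poly ?p (z i) = z i * poly (pderiv (\<Prod>i<n. [:z i, -1:])) (z i)"
        using that by (auto simp: z(1) poly_prod)
      ultimately have "(-1) ^ Suc i * poly ?p (z i) = z i * ((-1) ^ i * (\<Prod>j<n-1. (z' j - z i)))"
        using poly_pderiv_prod_at_root[OF that, of z] by (simp del: laguerre.simps)
      then show ?thesis
        using \<open>(-1) ^ i * (\<Prod>j<n-1. (z' j - z i)) > 0\<close> z(3) that by (metis mult_pos_pos)
    qed
    have lc: "degree ?p = Suc n" "lead_coeff ?p = (-1) ^ Suc n"
      using degree_laguerre[of "Suc n" a] coeff_laguerre[of "Suc n" a]
      by (metis le_degree le_antisym neg_equal_0_iff_equal power_not_zero zero_neq_one,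
          metis le_degree le_antisym neg_equal_0_iff_equal power_not_zero zero_neq_one)
    have "\<exists>T0. \<forall>t\<ge>T0. poly (smult ((-1) ^ Suc n) ?p) t \<ge> lead_coeff (smult ((-1) ^ Suc n) ?p)"
      by (rule poly_pinfty_gt_lc) (use lc in \<open>simp_all del: laguerre.simps\<close>)
    moreover have "lead_coeff (smult ((-1) ^ Suc n) ?p) = 1"
      using lc by (simp del: laguerre.simps flip: power_add mult_2)
    ultimately obtain T0 where T0: "\<And>t. t \<ge> T0 \<Longrightarrow> poly (smult ((-1) ^ Suc n) ?p) t \<ge> 1" by auto
    define T where "T = \<bar>T0\<bar> + (\<Sum>i<n. z i) + 1"
    have z_sum: "z i \<le> (\<Sum>i<n. z i)" if "i < n" for i
      using z(3) that by (intro member_le_sum) (auto intro: less_imp_le)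
    have "(\<Sum>i<n. z i) \<ge> 0" using z(3) by (intro sum_nonneg) (auto intro: less_imp_le)
    then have T: "T \<ge> T0" "T > 0" unfolding T_def by linarith+
    have z_T: "z i < T" if "i < n" for i
      unfolding T_def using z_sum[OF that] by linarith
    define y where "y i = (if i = 0 then 0 else if i = Suc n then T else z (i - 1))" for i
    have ymono: "strict_mono_on {..Suc n} y"
    proof (rule strict_mono_onI)
      fix i j assume "i \<in> {..Suc n}" "j \<in> {..Suc n}" "i < j"
      then show "y i < y j"
        using T z_T z(3) by (auto simp: y_def intro!: strict_mono_onD[OF z(2)])
    qed
    have alt: "(-1) ^ i * poly ?p (y i) > 0" if "i \<le> Suc n" for i
    proof -
      consider "i = 0" | "i = Suc n" | j where "i = Suc j" "j < n"
        using \<open>i \<le> Suc n\<close> by (cases i) (auto simp: less_le)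
      then show ?thesis
      proof cases
        case 1
        then show ?thesis using poly_laguerre_0_pos[of "Suc n" a] by (simp add: y_def del: laguerre.simps)
      next
        case 2
        then show ?thesis using T0[OF T(1)] by (simp add: y_def del: laguerre.simps)
      next
        case 3
        then show ?thesis using pz[of j] by (simp add: y_def del: laguerre.simps)
      qed
    qed
    obtain w where w: "?p = (\<Prod>i<Suc n. [:w i, -1:])" "strict_mono_on {..<Suc n} w"
      "\<And>i. i < Suc n \<Longrightarrow> y i < w i"
      using alternating_poly_factorization[OF degree_laguerre coeff_laguerre ymono alt] by metis
    have "w i > 0" if "i < Suc n" for i
    proof -
      have "y 0 \<le> y i" using that by (intro strict_mono_on_leD[OF ymono]) auto
      then show ?thesis using w(3)[OF that] by (simp add: y_def)
    qed
    then show ?case using w by blast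
  qed
  then show thesis using that by blast
qed

section \<open>The perturbed radial profiles\<close>

text \<open>Makes a small multiple of \<open>M\<close> negligible against \<open>t ^ (2 * k)\<close>
  on a whole half-line. Away from 0 each lower power is at most a constant times the top
  power.\<close>

lemma poly_abs_le_power:
  fixes p :: "real poly"
  assumes "degree p \<le> n" "\<tau> > 0"
  obtains K where "K > 0" "\<And>t. t \<ge> \<tau> \<Longrightarrow> \<bar>poly p t\<bar> \<le> K * t ^ n"
proof -
  define K where "K = (\<Sum>i\<le>degree p. \<bar>coeff p i\<bar> / \<tau> ^ (n - i))"
  have "\<bar>poly p t\<bar> \<le> (K + 1) * t ^ n" if "t \<ge> \<tau>" for t
  proof -
    have "\<bar>poly p t\<bar> \<le> (\<Sum>i\<le>degree p. \<bar>coeff p i\<bar> * t ^ i)"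
      unfolding poly_altdef using that assms(2)
      by (intro order.trans[OF sum_abs]) (simp add: abs_mult power_abs)
    also have "\<dots> \<le> (\<Sum>i\<le>degree p. \<bar>coeff p i\<bar> / \<tau> ^ (n - i) * t ^ n)"
    proof (rule sum_mono)
      fix i assume "i \<in> {..degree p}"
      then have "t ^ n = t ^ (n - i) * t ^ i" using assms(1) by (simp flip: power_add)
      moreover have "\<tau> ^ (n - i) \<le> t ^ (n - i)" using that assms(2) by (intro power_mono) auto
      ultimately have "\<tau> ^ (n - i) * t ^ i \<le> t ^ n"
        using that assms(2) by (simp add: mult_right_mono)
      then have "t ^ i \<le> t ^ n / \<tau> ^ (n - i)" using assms(2) by (simp add: field_simps)
      then show "\<bar>coeff p i\<bar> * t ^ i \<le> \<bar>coeff p i\<bar> / \<tau> ^ (n - i) * t ^ n"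
        using mult_left_mono[of "t ^ i" "t ^ n / \<tau> ^ (n - i)" "\<bar>coeff p i\<bar>"] by simp
    qed
    also have "\<dots> = K * t ^ n" by (simp add: K_def sum_distrib_right)
    also have "\<dots> \<le> (K + 1) * t ^ n" using that assms(2) by (intro mult_right_mono) auto
    finally show ?thesis .
  qed
  moreover have "K \<ge> 0" using assms(2) by (auto simp: K_def intro!: sum_nonneg)
  ultimately show thesis using that[of "K + 1"] by auto
qed

lemma poly_abs_bounded_Icc:
  fixes p :: "real poly"
  obtains B where "B > 0" "\<And>t. t \<in> {a..b} \<Longrightarrow> \<bar>poly p t\<bar> \<le> B"
proof -
  have "bounded (poly p ` {a..b})"
    by (intro compact_imp_bounded compact_continuous_image continuous_intros compact_Icc)
  then show thesis using that by (auto simp: bounded_pos)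
qed

lemma no_root_imp_same_sign:
  fixes p :: "real poly"
  assumes "\<And>t. t \<in> {a..b} \<Longrightarrow> poly p t \<noteq> 0" "x \<in> {a..b}" "y \<in> {a..b}" "poly p x > 0"
  shows "poly p y > 0"
proof (rule ccontr)
  assume "\<not> poly p y > 0"
  then have "poly p y < 0" using assms by (meson not_less_iff_gr_or_eq)
  consider "x < y" | "y < x" | "x = y" by linarith
  then show False
  proof cases
    case 1
    show ?thesis using poly_IVT_neg[OF 1 assms(4) \<open>poly p y < 0\<close>] assms(1-3) by force
  next
    case 2
    show ?thesis using poly_IVT_pos[OF 2 \<open>poly p y < 0\<close> assms(4)] assms(1-3) by force
  qed (use \<open>poly p y < 0\<close> assms(4) in simp)
qed

lemma mono_poly_Icc:
  fixes p :: "real poly"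
  assumes "\<And>t. t \<in> {a..b} \<Longrightarrow> poly (pderiv p) t \<ge> 0" "a \<le> x" "x \<le> y" "y \<le> b"
  shows "poly p x \<le> poly p y"
  by (rule DERIV_nonneg_imp_nondecreasing[OF assms(3)]) (use assms in \<open>auto intro!: exI[of _ "poly (pderiv p) _"] poly_DERIV\<close>)

lemma anti_mono_poly_Icc:
  fixes p :: "real poly"
  assumes "\<And>t. t \<in> {a..b} \<Longrightarrow> poly (pderiv p) t \<le> 0" "a \<le> x" "x \<le> y" "y \<le> b"
  shows "poly p y \<le> poly p x"
  by (rule DERIV_nonpos_imp_nonincreasing[OF assms(3)]) (use assms in \<open>auto intro!: exI[of _ "poly (pderiv p) _"] poly_DERIV\<close>)

text \<open>Smallness conditions on a radius are phrased as eventualities at 0 from the right, so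
  that finitely many of them are met by one radius.\<close>

lemma eventually_at_0_right_ball:
  assumes "\<And>t. continuous (at t) f" "f (z::real) > (c::real)"
  shows "eventually (\<lambda>d. \<forall>t\<in>{z-d..z+d}. f t > c) (at_right 0)"
proof -
  have "eventually (\<lambda>t. f t > c) (nhds z)"
    using assms(1)[of z] assms(2) by (intro order_tendstoD(1)[of f "f z"])
      (simp add: continuous_within tendsto_at_iff_tendsto_nhds)
  then obtain e where "e > 0" "\<And>t. dist t z < e \<Longrightarrow> f t > c"
    by (auto simp: eventually_nhds_metric)
  then show ?thesis
    unfolding eventually_at_right_field
    by (intro exI[of _ e]) (auto simp: dist_real_def abs_if)
qed

text \<open>The function of the overview, without the Gaussian, on a ray with
  \<open>cos (2 * k * \<theta>) = \<sigma>\<close> for \<open>\<sigma>\<close> equal to 1 or -1: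
  there \<open>Re (z ^ (2 * k)) = \<sigma> * t ^ k\<close> and
  \<open>Re (z ^ (4 * k)) = t ^ (2 * k)\<close>.\<close>

definition ray_poly :: "nat \<Rightarrow> real poly \<Rightarrow> real poly \<Rightarrow> real \<Rightarrow> real \<Rightarrow> real \<Rightarrow> real poly" where
  "ray_poly k L M \<epsilon> \<delta> \<sigma> =
     smult \<sigma> (monom 1 k * L) + monom \<epsilon> (2 * k) - smult \<delta> M"

lemma poly_ray_poly:
  "poly (ray_poly k L M \<epsilon> \<delta> \<sigma>) t = \<sigma> * (t ^ k * poly L t) + \<epsilon> * t ^ (2 * k) - \<delta> * poly M t"
  by (simp add: ray_poly_def poly_monom)

text \<open>Near the origin \<open>t ^ k * L\<close> is small, and the term
  \<open>- \<delta> * M\<close> decides the sign and the monotonicity; \<open>M0\<close> makes it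
  negative and increasing there.\<close>

locale perturbed_ray =
  fixes k :: nat and z :: "nat \<Rightarrow> real" and L M :: "real poly"
  assumes k: "k \<ge> 1"
    and L: "L = (\<Prod>i<k. [:z i, -1:])"
    and z_mono: "strict_mono_on {..<k} z"
    and z_pos: "\<And>i. i < k \<Longrightarrow> z i > 0"
    and M_deg: "degree M \<le> 2 * k"
    and M0: "poly M 0 > 0" "poly (pderiv M) 0 < 0"
begin

abbreviation F :: "real poly" where "F \<equiv> monom 1 k * L"

lemma poly_L: "poly L t = (\<Prod>i<k. (z i - t))"
  by (simp add: L poly_prod)

lemma poly_F: "poly F t = t ^ k * poly L t"
  by (simp add: poly_monom)

lemma z_less: "i < j \<Longrightarrow> j < k \<Longrightarrow> z i < z j"
  by (intro strict_mono_onD[OF z_mono]) auto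

lemma z_le: "i \<le> j \<Longrightarrow> j < k \<Longrightarrow> z i \<le> z j"
  using z_less[of i j] by (cases "i = j") auto

lemma pderiv_F_root: "i < k \<Longrightarrow> poly (pderiv F) (z i) \<noteq> 0"
proof -
  assume i: "i < k"
  have "poly L (z i) = 0" using i by (auto simp: poly_L)
  moreover have "poly (pderiv L) (z i) \<noteq> 0"
  proof -
    have "z j \<noteq> z i" if "j \<in> {..<k} - {i}" for j
      using that i z_less[of i j] z_less[of j i] by (cases "i < j") auto
    then show ?thesis
      unfolding L using poly_pderiv_prod_at_root[OF i, of z] by (auto simp: prod_zero_iff)
  qed
  ultimately show ?thesis using z_pos[OF i] by (simp add: pderiv_mult poly_monom)
qed

lemma L_pos_left: "t < z 0 \<Longrightarrow> poly L t > 0"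
  unfolding poly_L using z_le[of 0] by (intro prod_pos) force

text \<open>The derivative is \<open>t ^ (k - 1)\<close> times \<open>k * L + t * L'\<close>, and
  the second factor is positive at 0 because \<open>L\<close> is.\<close>

lemma pderiv_F_nonneg: "eventually (\<lambda>\<tau>. \<forall>t\<in>{0..\<tau>}. poly (pderiv F) t \<ge> 0) (at_right 0)"
proof -
  let ?g = "\<lambda>t. real k * poly L t + t * poly (pderiv L) t"
  have "?g 0 > 0" using L_pos_left[of 0] z_pos[of 0] k by simp
  then have "eventually (\<lambda>\<tau>. \<forall>t\<in>{0-\<tau>..0+\<tau>}. ?g t > 0) (at_right 0)"
    by (intro eventually_at_0_right_ball continuous_intros)
  then show ?thesis
  proof (rule eventually_mono)
    fix \<tau> :: real assume *: "\<forall>t\<in>{0-\<tau>..0+\<tau>}. ?g t > 0"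
    have "poly (pderiv F) t \<ge> 0" if "t \<in> {0..\<tau>}" for t
    proof -
      have "poly (pderiv F) t = t ^ (k - 1) * ?g t"
        using k by (cases k) (simp_all add: pderiv_mult pderiv_monom poly_monom algebra_simps)
      moreover have "?g t > 0" using * that by auto
      ultimately show ?thesis using that by simp
    qed
    then show "\<forall>t\<in>{0..\<tau>}. poly (pderiv F) t \<ge> 0" by blast
  qed
qed

text \<open>Near a zero of \<^term>\<open>L\<close> the derivative of \<^term>\<open>F\<close> dominates that of the perturbation;
  away from the zeros \<^term>\<open>F\<close> itself dominates, uniformly up to infinity.\<close>

lemma F_lower_bound:
  assumes d: "d > 0" "\<And>i. i < k \<Longrightarrow> d < z i" and t: "t > 0" "\<And>i. i < k \<Longrightarrow> \<bar>t - z i\<bar> \<ge> d"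
  shows "\<bar>poly F t\<bar> \<ge> (d / (z (k - 1) + d)) ^ k * t ^ (2 * k)"
proof -
  let ?\<rho> = "d / (z (k - 1) + d)"
  have zk: "z (k - 1) > 0" using k by (intro z_pos) auto
  \<comment> \<open>For admissible \<open>t\<close> the ratio of \<open>\<bar>z i - t\<bar>\<close>
    to \<open>t\<close> is smallest at \<open>t = z i + d\<close>, with value
    \<open>d / (z i + d)\<close>; the largest zero gives the worst of these constants.\<close>
  have "?\<rho> * t \<le> \<bar>z i - t\<bar>" if "i < k" for i
  proof (cases "t \<ge> z i")
    case True
    then have ge: "t \<ge> z i + d" using t(2)[OF that] by auto
    have zi: "z i \<le> z (k - 1)" "z i > 0" using that by (auto intro: z_le z_pos)
    have "d * t \<le> (t - z i) * (z i + d)"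
    proof -
      have "0 \<le> z i * (t - (z i + d))" using ge zi by auto
      then show ?thesis by (simp add: algebra_simps)
    qed
    also have "\<dots> \<le> (t - z i) * (z (k - 1) + d)" using zi ge d(1) by (intro mult_left_mono) auto
    finally show ?thesis using True zk d(1) by (simp add: field_simps)
  next
    case False
    then have le: "t \<le> z i - d" using t(2)[OF that] by auto
    have zi: "z i \<le> z (k - 1)" "z i > 0" using that by (auto intro: z_le z_pos)
    have "d * t \<le> d * (z (k - 1) + d)" using le zi d(1) by (intro mult_left_mono) auto
    also have "\<dots> \<le> (z i - t) * (z (k - 1) + d)" using le zi d(1) by (intro mult_right_mono) auto
    finally show ?thesis using False zk d(1) by (simp add: field_simps)
  qed
  then have "(\<Prod>i<k. ?\<rho> * t) \<le> (\<Prod>i<k. \<bar>z i - t\<bar>)"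
    using zk d(1) t(1) by (intro prod_mono) auto
  then have "?\<rho> ^ k * t ^ k \<le> \<bar>poly L t\<bar>"
    by (simp only: poly_L abs_prod prod_constant card_lessThan power_mult_distrib)
  then have "t ^ k * (?\<rho> ^ k * t ^ k) \<le> t ^ k * \<bar>poly L t\<bar>"
    using t(1) by (intro mult_left_mono) auto
  moreover have "t ^ (2 * k) = t ^ k * t ^ k" by (simp add: mult_2 power_add)
  ultimately show ?thesis using t(1) unfolding poly_F
    by (simp only: abs_mult power_abs abs_of_pos mult_ac)
qed

text \<open>The parameters are fixed in the order \<open>d\<close>, \<open>\<tau>\<close>,
  \<open>\<epsilon>\<close>, \<open>\<delta>\<close>. The points \<open>s i\<close> sample the
  intervals between the zeros of \<open>L\<close>. The last conclusion says that every interval of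
  positivity on a ray reaches a sample point, so sample points can represent the positive nodal
  domains.\<close>

lemma perturbation:
  obtains \<epsilon> \<delta> s where "\<epsilon> > 0" "\<delta> > 0" "\<And>t. t \<ge> 0 \<Longrightarrow> \<epsilon> * t ^ (2 * k) + \<delta> * poly M t > 0"
    "strict_mono_on {..k} s" "s 0 > 0"
    "\<And>i \<sigma>. i \<le> k \<Longrightarrow> \<sigma> \<in> {1, -1} \<Longrightarrow> (-1) ^ i * \<sigma> * poly (ray_poly k L M \<epsilon> \<delta> \<sigma>) (s i) > 0"
    "\<And>t \<sigma>. t > 0 \<Longrightarrow> \<sigma> \<in> {1, -1} \<Longrightarrow> poly (ray_poly k L M \<epsilon> \<delta> \<sigma>) t = 0 \<Longrightarrow>
       poly (pderiv (ray_poly k L M \<epsilon> \<delta> \<sigma>)) t \<noteq> 0"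
    "\<And>t \<sigma>. t > 0 \<Longrightarrow> \<sigma> \<in> {1, -1} \<Longrightarrow> poly (ray_poly k L M \<epsilon> \<delta> \<sigma>) t > 0 \<Longrightarrow>
       \<exists>i\<le>k. \<forall>x\<in>closed_segment t (s i). poly (ray_poly k L M \<epsilon> \<delta> \<sigma>) x > 0"
proof -
  \<comment> \<open>Half the smallest slope of \<open>F\<close> at its zeros, so that the slope
    still exceeds \<open>m\<close> on neighbourhoods of the zeros.\<close>
  define m where "m = Min ((\<lambda>i. \<bar>poly (pderiv F) (z i)\<bar>) ` {..<k}) / 2"
  have Min_pos: "Min ((\<lambda>i. \<bar>poly (pderiv F) (z i)\<bar>) ` {..<k}) > 0"
    using k pderiv_F_root by (subst Min_gr_iff) (auto simp: lessThan_empty_iff)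
  have m: "m > 0" "m < \<bar>poly (pderiv F) (z i)\<bar>" if "i < k" for i
  proof -
    have "Min ((\<lambda>i. \<bar>poly (pderiv F) (z i)\<bar>) ` {..<k}) \<le> \<bar>poly (pderiv F) (z i)\<bar>"
      using that by (intro Min_le) auto
    then show "m > 0" "m < \<bar>poly (pderiv F) (z i)\<bar>" using Min_pos unfolding m_def by linarith+
  qed
  have m0: "m > 0" using k m(1)[of 0] by simp
  have "eventually (\<lambda>d. \<forall>i\<in>{..<k}. \<forall>t\<in>{z i - d..z i + d}. \<bar>poly (pderiv F) t\<bar> > m) (at_right 0)"
    using m(2) by (intro eventually_ball_finite ballI eventually_at_0_right_ball continuous_intros) auto
  moreover have small: "eventually (\<lambda>d. d < a) (at_right 0)" if "a > 0" for a :: real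
    using that by (auto simp: eventually_at_right_field)
  have "eventually (\<lambda>d. \<forall>i\<in>{..<k}. d < z i) (at_right 0)"
    using z_pos by (intro eventually_ball_finite ballI small) auto
  moreover have "eventually (\<lambda>d. \<forall>i\<in>{..<k-1}. d < (z (Suc i) - z i) / 2) (at_right 0)"
    using z_less by (intro eventually_ball_finite ballI small) auto
  moreover have "eventually (\<lambda>d. d > (0::real)) (at_right 0)" by (rule eventually_at_right_less)
  ultimately have "eventually (\<lambda>d. d > 0 \<and> (\<forall>i\<in>{..<k}. d < z i) \<and>
      (\<forall>i\<in>{..<k-1}. d < (z (Suc i) - z i) / 2) \<and>
      (\<forall>i\<in>{..<k}. \<forall>t\<in>{z i - d..z i + d}. \<bar>poly (pderiv F) t\<bar> > m)) (at_right 0)"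
    by eventually_elim blast
  then obtain d where d0: "d > 0 \<and> (\<forall>i\<in>{..<k}. d < z i) \<and>
      (\<forall>i\<in>{..<k-1}. d < (z (Suc i) - z i) / 2) \<and>
      (\<forall>i\<in>{..<k}. \<forall>t\<in>{z i - d..z i + d}. \<bar>poly (pderiv F) t\<bar> > m)"
    using eventually_happens'[OF trivial_limit_at_right_real[of 0]] by blast
  have d: "d > 0" "\<And>i. i < k \<Longrightarrow> d < z i"
      "\<And>i t. i < k \<Longrightarrow> t \<in> {z i - d..z i + d} \<Longrightarrow> \<bar>poly (pderiv F) t\<bar> > m"
    using d0 by (simp_all del: atLeastAtMost_iff)
  have d_gap: "z i + d < z (Suc i) - d" if "Suc i < k" for i
  proof -
    have "d < (z (Suc i) - z i) / 2" using d0 that by simp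
    then show ?thesis by (simp add: field_simps)
  qed
  have d3: "z i + d < z j - d" if "i < j" "j < k" for i j
  proof -
    have "z (Suc i) \<le> z j" using that by (intro z_le) auto
    then show ?thesis using d_gap[of i] that by simp
  qed

  have "eventually (\<lambda>\<tau>. \<forall>t\<in>{0-\<tau>..0+\<tau>}. poly M t > 0) (at_right 0)"
    using M0 by (intro eventually_at_0_right_ball continuous_intros) auto
  moreover have "eventually (\<lambda>\<tau>. \<forall>t\<in>{0-\<tau>..0+\<tau>}. - poly (pderiv M) t > 0) (at_right 0)"
    using M0 by (intro eventually_at_0_right_ball continuous_intros) auto
  moreover note pderiv_F_nonneg
  moreover have "eventually (\<lambda>\<tau>. \<tau> < z 0 - d) (at_right 0)"
    using d k by (intro small) auto
  moreover have "eventually (\<lambda>d. d > (0::real)) (at_right 0)" by (rule eventually_at_right_less)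
  ultimately have "eventually (\<lambda>\<tau>. 0 < \<tau> \<and> \<tau> < z 0 - d \<and>
     (\<forall>t\<in>{0..\<tau>}. poly M t > 0 \<and> poly (pderiv M) t < 0 \<and> poly (pderiv F) t \<ge> 0)) (at_right 0)"
    by eventually_elim auto
  then obtain \<tau> where \<tau>: "0 < \<tau>" "\<tau> < z 0 - d"
    "\<And>t. t \<in> {0..\<tau>} \<Longrightarrow> poly M t > 0 \<and> poly (pderiv M) t < 0 \<and> poly (pderiv F) t \<ge> 0"
    using eventually_happens'[OF trivial_limit_at_right_real[of 0]] by blast

  obtain K where K: "K > 0" "\<And>t. t \<ge> \<tau> \<Longrightarrow> \<bar>poly M t\<bar> \<le> K * t ^ (2 * k)"
    using poly_abs_le_power[OF M_deg \<tau>(1)] by blast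
  define T where "T = z (k - 1) + d"
  have T: "T > 0" using d(1) z_pos[of "k - 1"] k by (simp add: T_def)
  obtain B1 where B1: "B1 > 0" "\<And>t. t \<in> {0..T} \<Longrightarrow> \<bar>poly (pderiv M) t\<bar> \<le> B1"
    using poly_abs_bounded_Icc by blast
  obtain B2 where B2: "B2 > 0" "\<And>t. t \<in> {0..T} \<Longrightarrow> \<bar>poly (pderiv (monom 1 (2 * k))) t\<bar> \<le> B2"
    using poly_abs_bounded_Icc by blast
  define \<kappa> where "\<kappa> = (d / T) ^ k"
  have \<kappa>: "\<kappa> > 0" using d(1) T by (simp add: \<kappa>_def)
  have Flow: "\<bar>poly F t\<bar> \<ge> \<kappa> * t ^ (2 * k)" if "t > 0" "\<And>i. i < k \<Longrightarrow> \<bar>t - z i\<bar> \<ge> d" for t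
    using F_lower_bound[OF d(1,2) that] by (simp add: \<kappa>_def T_def)

  \<comment> \<open>The bound \<open>\<kappa> / 3\<close> gives
    \<open>2 * \<epsilon> < \<kappa>\<close>, leaving room for both perturbing terms away from the
    zeros of \<open>L\<close>. The bound \<open>m / (2 * B2)\<close> spends half of the slope
    \<open>m\<close> near the zeros; \<open>\<delta>\<close> gets the other half.\<close>
  define \<epsilon> where "\<epsilon> = min (\<kappa> / 3) (m / (2 * B2))"
  have \<epsilon>: "\<epsilon> > 0" "2 * \<epsilon> < \<kappa>" "\<epsilon> * B2 \<le> m / 2"
    using \<kappa> m0 B2(1) by (auto simp: \<epsilon>_def min_def field_simps)
  \<comment> \<open>The first bound makes \<open>\<delta> * \<bar>M\<bar>\<close> smaller than
    \<open>\<epsilon> * t ^ (2 * k)\<close> from \<open>\<tau>\<close> on.\<close>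
  define \<delta> where "\<delta> = min (\<epsilon> / (2 * K)) (m / (2 * B1))"
  have "\<delta> \<le> \<epsilon> / (2 * K)" "\<delta> \<le> m / (2 * B1)" by (simp_all add: \<delta>_def)
  then have "2 * (\<delta> * K) \<le> \<epsilon>" "\<delta> * B1 \<le> m / 2"
    using K(1) B1(1) by (simp_all add: field_simps)
  moreover have "\<delta> > 0" using \<epsilon>(1) m0 K(1) B1(1) by (simp add: \<delta>_def)
  ultimately have \<delta>: "\<delta> > 0" "\<delta> * K < \<epsilon>" "\<delta> * B1 \<le> m / 2"
    using \<epsilon>(1) by linarith+

  have dM: "\<delta> * \<bar>poly M t\<bar> < \<epsilon> * t ^ (2 * k)" if "t \<ge> \<tau>" for t
  proof -
    have "\<delta> * \<bar>poly M t\<bar> \<le> \<delta> * (K * t ^ (2 * k))" using K(2)[OF that] \<delta>(1) by (intro mult_left_mono) auto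
    also have "\<dots> < \<epsilon> * t ^ (2 * k)" using \<delta>(2) that \<tau>(1) by (simp flip: mult.assoc)
    finally show ?thesis .
  qed
  have A: "\<epsilon> * t ^ (2 * k) + \<delta> * poly M t > 0" if "t \<ge> 0" for t
  proof (cases "t \<ge> \<tau>")
    case True
    have "- (\<delta> * poly M t) \<le> \<delta> * \<bar>poly M t\<bar>"
      using \<delta>(1) by (metis abs_ge_minus_self abs_mult abs_of_pos)
    then show ?thesis using dM[OF True] by linarith
  next
    case False
    then have "\<delta> * poly M t > 0" using \<tau>(3)[of t] that \<delta>(1) by simp
    then show ?thesis using \<epsilon>(1) that by (simp add: add_nonneg_pos)
  qed

  let ?G = "ray_poly k L M \<epsilon> \<delta>"
  have G': "poly (pderiv (?G \<sigma>)) t = \<sigma> * poly (pderiv F) t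
      + (\<epsilon> * poly (pderiv (monom 1 (2 * k))) t - \<delta> * poly (pderiv M) t)" for \<sigma> t
  proof -
    have "monom \<epsilon> (2 * k) = smult \<epsilon> (monom 1 (2 * k))" by (simp add: smult_monom)
    then show ?thesis
      unfolding ray_poly_def by (simp only: pderiv_add pderiv_diff pderiv_smult) simp
  qed
  \<comment> \<open>For \<open>\<sigma>\<close> equal to 1 or -1 this makes the derivative nonzero,
    so the ray polynomial is strictly monotone within \<open>d\<close> of each zero of
    \<open>L\<close>.\<close>
  have near: "\<bar>poly (pderiv (?G \<sigma>)) t - \<sigma> * poly (pderiv F) t\<bar> < \<bar>poly (pderiv F) t\<bar>"
    if "i < k" "t \<in> {z i - d..z i + d}" for i t \<sigma>
  proof -
    have "z i \<le> z (k - 1)" using that by (intro z_le) auto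
    then have t: "t \<in> {0..T}" using that d(2)[OF that(1)] by (auto simp: T_def)
    have "\<bar>\<epsilon> * poly (pderiv (monom 1 (2 * k))) t - \<delta> * poly (pderiv M) t\<bar>
       \<le> \<epsilon> * \<bar>poly (pderiv (monom 1 (2 * k))) t\<bar> + \<delta> * \<bar>poly (pderiv M) t\<bar>"
      using \<epsilon>(1) \<delta>(1) abs_triangle_ineq4 by (metis abs_mult abs_of_pos)
    also have "\<dots> \<le> \<epsilon> * B2 + \<delta> * B1"
      using B1(2)[OF t] B2(2)[OF t] \<epsilon>(1) \<delta>(1) by (intro add_mono mult_left_mono) auto
    also have "\<dots> \<le> m" using \<epsilon>(3) \<delta>(3) by simp
    also have "\<dots> < \<bar>poly (pderiv F) t\<bar>" using d(3)[OF that] .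
    finally show ?thesis by (simp add: G')
  qed
  \<comment> \<open>Beyond \<open>\<tau>\<close> and away from the zeros of \<open>L\<close>, the
    ray polynomial has the sign of \<open>\<sigma> * F\<close>.\<close>
  have far: "\<sigma> * poly F t > 0 \<longleftrightarrow> poly (?G \<sigma>) t > 0" "poly (?G \<sigma>) t \<noteq> 0"
    if "t \<ge> \<tau>" "\<And>i. i < k \<Longrightarrow> \<bar>t - z i\<bar> \<ge> d" "\<sigma> \<in> {1, -1}" for t \<sigma>
  proof -
    have "t > 0" using that \<tau>(1) by simp
    have "\<kappa> * t ^ (2 * k) > 2 * \<epsilon> * t ^ (2 * k)"
      using \<epsilon>(2) \<open>t > 0\<close> by (intro mult_strict_right_mono) auto
    then have "\<bar>poly F t\<bar> > \<epsilon> * t ^ (2 * k) + \<delta> * \<bar>poly M t\<bar>"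
      using Flow[OF \<open>t > 0\<close> that(2)] dM[OF that(1)] by linarith
    moreover have "\<delta> * \<bar>poly M t\<bar> = \<bar>\<delta> * poly M t\<bar>" "\<epsilon> * t ^ (2 * k) > 0"
      using \<delta>(1) \<epsilon>(1) \<open>t > 0\<close> by (simp_all add: abs_mult)
    ultimately have "\<bar>\<epsilon> * t ^ (2 * k) - \<delta> * poly M t\<bar> < \<bar>poly F t\<bar>" by linarith
    moreover have "poly (?G \<sigma>) t = \<sigma> * poly F t + (\<epsilon> * t ^ (2 * k) - \<delta> * poly M t)"
      unfolding poly_F by (simp add: poly_ray_poly)
    ultimately show "\<sigma> * poly F t > 0 \<longleftrightarrow> poly (?G \<sigma>) t > 0" "poly (?G \<sigma>) t \<noteq> 0"
      using that(3) by auto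
  qed
  \<comment> \<open>For \<open>\<sigma> = 1\<close> none of the three terms decreases on this
    interval, and \<open>- \<delta> * M\<close> increases strictly.\<close>
  have zero1: "poly (pderiv (?G 1)) t > 0" if "t \<in> {0..\<tau>}" for t
  proof -
    have "poly (pderiv (monom 1 (2 * k))) t \<ge> 0" using that by (simp add: pderiv_monom poly_monom)
    then have "\<epsilon> * poly (pderiv (monom 1 (2 * k))) t \<ge> 0" using \<epsilon>(1) by simp
    moreover have "\<delta> * poly (pderiv M) t < 0" using \<tau>(3)[OF that] \<delta>(1) by (simp add: mult_pos_neg)
    ultimately show ?thesis unfolding G' using \<tau>(3)[OF that] by simp
  qed
  have left_far: "\<bar>t - z i\<bar> \<ge> d" if "t \<le> z 0 - d" "i < k" for t i
    using z_le[of 0 i] that by auto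
  \<comment> \<open>For \<open>\<sigma> = -1\<close>, \<open>F\<close> exceeds
    \<open>2 * \<epsilon> * t ^ (2 * k)\<close>, so what remains is below
    \<open>- (\<epsilon> * t ^ (2 * k) + \<delta> * M)\<close>, which is negative by
    \<open>A\<close>.\<close>
  have zero2: "poly (?G (-1)) t < 0" if "0 < t" "t \<le> z 0 - d" for t
  proof -
    have "poly F t > 0" unfolding poly_F using L_pos_left[of t] that d(1) by simp
    then have "poly F t \<ge> \<kappa> * t ^ (2 * k)"
      using Flow[OF that(1) left_far[OF that(2)]] by simp
    moreover have "\<kappa> * t ^ (2 * k) > 2 * \<epsilon> * t ^ (2 * k)"
      using \<epsilon>(2) that by (intro mult_strict_right_mono) auto
    moreover have "\<epsilon> * t ^ (2 * k) > 0" using \<epsilon>(1) that by simp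
    moreover have "poly (?G (-1)) t = - poly F t + \<epsilon> * t ^ (2 * k) - \<delta> * poly M t"
      unfolding poly_F by (simp add: poly_ray_poly)
    moreover have "\<epsilon> * t ^ (2 * k) + \<delta> * poly M t > 0" using A that by simp
    ultimately show ?thesis by linarith
  qed

  \<comment> \<open>Exactly \<open>i\<close> zeros of \<open>L\<close> lie below \<open>s i\<close>:
    the point \<open>s 0\<close> precedes the first zero, and \<open>s (Suc j)\<close> follows
    \<open>z j\<close> at distance \<open>d\<close>.\<close>
  define s where "s i = (if i = 0 then z 0 - d else z (i - 1) + d)" for i
  have s_far: "\<bar>s i - z j\<bar> \<ge> d" if "i \<le> k" "j < k" for i j
  proof (cases "i = 0")
    case True
    then show ?thesis using left_far[of "s i" j] that by (simp add: s_def)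
  next
    case False
    then have "i - 1 < k" using that by simp
    with False show ?thesis using d3[of "i - 1" j] d3[of j "i - 1"] d(1) that
      by (cases "j < i - 1"; cases "j = i - 1") (auto simp: s_def)
  qed
  have s_tau: "s i > \<tau>" if "i \<le> k" for i
  proof (cases "i = 0")
    case False
    then have "i - 1 < k" using that k by simp
    then show ?thesis using False \<tau>(2) d(1) z_le[of 0 "i - 1"] by (auto simp: s_def)
  qed (use \<tau>(2) in \<open>simp add: s_def\<close>)
  have s_mono: "strict_mono_on {..k} s"
  proof (rule strict_mono_onI)
    fix i j assume ij: "i \<in> {..k}" "j \<in> {..k}" "i < j"
    then have "j - 1 < k" by auto
    with ij show "s i < s j"
      using d(1) z_le[of 0 "j - 1"] z_less[of "i - 1" "j - 1"] by (auto simp: s_def)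
  qed
  have s_sign: "(-1) ^ i * \<sigma> * poly (?G \<sigma>) (s i) > 0" if "i \<le> k" "\<sigma> \<in> {1, -1}" for i \<sigma>
  proof -
    have "(-1) ^ i * poly L (s i) > 0"
      unfolding poly_L
    proof (rule prod_alternating_sign[OF that(1)])
      fix j assume "j < i"
      with that have "i - 1 < k" "j \<le> i - 1" by simp_all
      with \<open>j < i\<close> show "z j < s i" using z_le[of j "i - 1"] that d(1) by (auto simp: s_def)
    next
      fix j assume "i \<le> j" "j < k"
      show "s i < z j"
      proof (cases "i = 0")
        case True
        then show ?thesis using z_le[of 0 j] \<open>j < k\<close> d(1) by (simp add: s_def)
      next
        case False
        then have "i - 1 < j" using \<open>i \<le> j\<close> by simp
        with False show ?thesis using d3[of "i - 1" j] \<open>j < k\<close> d(1) by (simp add: s_def)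
      qed
    qed
    moreover have "s i ^ k > 0" using s_tau[OF that(1)] \<tau>(1) by simp
    ultimately have "s i ^ k * ((-1) ^ i * poly L (s i)) > 0" by (rule mult_pos_pos[rotated])
    then have "(-1) ^ i * poly F (s i) > 0"
      unfolding poly_F by (simp only: mult.left_commute)
    moreover have "\<sigma> * poly F (s i) > 0 \<longleftrightarrow> poly (?G \<sigma>) (s i) > 0" "poly (?G \<sigma>) (s i) \<noteq> 0"
      using far[OF less_imp_le[OF s_tau[OF that(1)]] s_far[OF that(1)] that(2)] by auto
    ultimately show ?thesis using that(2)
      by (cases "even i") (auto simp: not_less)
  qed

  have gap: "poly (?G \<sigma>) y > 0"
    if \<sigma>: "\<sigma> \<in> {1, -1}" and "poly (?G \<sigma>) x > 0" "x \<in> {a..b}" "y \<in> {a..b}" and a: "\<tau> \<le> a"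
       and clear: "\<And>i. i < k \<Longrightarrow> z i + d \<le> a \<or> b \<le> z i - d" for \<sigma> x y a b
  proof (rule no_root_imp_same_sign[OF _ \<open>x \<in> _\<close> \<open>y \<in> _\<close> \<open>poly (?G \<sigma>) x > 0\<close>])
    fix t assume t: "t \<in> {a..b}"
    have "\<bar>t - z i\<bar> \<ge> d" if "i < k" for i using clear[OF that] t by auto
    then show "poly (?G \<sigma>) t \<noteq> 0" using far(2)[of t \<sigma>] t a \<sigma> by auto
  qed
  \<comment> \<open>Before \<open>z 0 - d\<close> only \<open>\<sigma> = 1\<close> can be positive,
    and positivity persists up to \<open>s 0\<close>. Otherwise let \<open>z i\<close> be the last
    zero with \<open>z i - d < t\<close>. Past its window, go back to \<open>s (Suc i)\<close>.
    Inside the window the ray polynomial is monotone: if increasing, go right to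
    \<open>s (Suc i)\<close>; if decreasing, go left, and for \<open>i > 0\<close> on across the
    root-free gap, to \<open>s i\<close>.\<close>
  have seg: "\<exists>i\<le>k. \<forall>x\<in>closed_segment t (s i). poly (?G \<sigma>) x > 0"
    if t: "t > 0" and \<sigma>: "\<sigma> \<in> {1, -1}" and pos: "poly (?G \<sigma>) t > 0" for t \<sigma>
  proof (cases "t \<le> z 0 - d")
    case True
    then have "\<sigma> = 1" using zero2[OF t] pos \<sigma> by auto
    have "poly (?G \<sigma>) x > 0" if "x \<in> {t..z 0 - d}" for x
    proof -
      have *: "poly (?G \<sigma>) y > 0" if "y \<in> {t..\<tau>}" for y
        using mono_poly_Icc[of 0 \<tau> "?G 1" t y] zero1 that t pos \<open>\<sigma> = 1\<close> by fastforce
      have "\<exists>y \<in> {\<tau>..z 0 - d}. poly (?G \<sigma>) y > 0"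
        using *[of \<tau>] True \<tau>(2) pos by (cases "t \<le> \<tau>") auto
      then have "poly (?G \<sigma>) x > 0" if "x \<ge> \<tau>"
        using gap[OF \<sigma>, of _ \<tau> "z 0 - d" x] z_le[of 0] \<open>x \<in> _\<close> that \<tau>(2) by force
      then show ?thesis using * that by fastforce
    qed
    then show ?thesis using True by (intro exI[of _ 0]) (auto simp: s_def closed_segment_eq_real_ivl)
  next
    case False
    define i where "i = Max {j. j < k \<and> z j - d < t}"
    have fin: "finite {j. j < k \<and> z j - d < t}" "{j. j < k \<and> z j - d < t} \<noteq> {}"
      using False k by (auto intro: exI[of _ 0])
    have i: "i < k" "z i - d < t" using Max_in[OF fin] by (auto simp: i_def)
    have after: "t \<le> z j - d" if "i < j" "j < k" for j
    proof (rule ccontr)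
      assume "\<not> t \<le> z j - d"
      then have "j \<le> i" unfolding i_def using that fin(1) by (intro linorder_class.Max_ge) auto
      then show False using that by simp
    qed
    have other: "z j + d \<le> z i + d \<or> b \<le> z j - d" if "b \<le> max t (z i + d)" "j < k" for b j
    proof (cases "j \<le> i")
      case False
      then show ?thesis using after[of j] d3[of i j] that by auto
    qed (use z_le[of j i] i in auto)
    have \<tau>i: "\<tau> \<le> z i - d" "\<tau> \<le> z i + d" using \<tau>(2) z_le[of 0 i] i(1) d(1) by auto
    show ?thesis
    proof (cases "t \<ge> z i + d")
      case True
      have "poly (?G \<sigma>) x > 0" if "x \<in> {z i + d..t}" for x
        by (rule gap[OF \<sigma> pos, of "z i + d" t]) (use that True \<tau>i other in auto)
      then show ?thesis using i True
        by (intro exI[of _ "Suc i"]) (auto simp: s_def closed_segment_eq_real_ivl)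
    next
      case False
      let ?I = "{z i - d..z i + d}"
      have tI: "t \<in> ?I" using False i by auto
      have nz: "poly (pderiv (?G \<sigma>)) x \<noteq> 0" if "x \<in> ?I" for x
        using near[OF i(1) that, of \<sigma>] \<sigma> by auto
      consider "\<forall>x\<in>?I. poly (pderiv (?G \<sigma>)) x \<ge> 0" | "\<forall>x\<in>?I. poly (pderiv (?G \<sigma>)) x \<le> 0"
      proof (cases "poly (pderiv (?G \<sigma>)) t > 0")
        case True
        then show thesis
          using that(1) no_root_imp_same_sign[OF nz tI] by (meson less_imp_le)
      next
        case False
        then have "poly (- pderiv (?G \<sigma>)) t > 0" using nz[OF tI] by auto
        then have "poly (- pderiv (?G \<sigma>)) x > 0" if "x \<in> ?I" for x
          using no_root_imp_same_sign[of "z i - d" "z i + d" "- pderiv (?G \<sigma>)" t x] nz tI that by auto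
        then show thesis using that(2) by (force simp: less_imp_le)
      qed
      then show ?thesis
      proof cases
        case 1
        then have "poly (?G \<sigma>) x > 0" if "x \<in> {t..z i + d}" for x
          using mono_poly_Icc[of "z i - d" "z i + d" "?G \<sigma>" t x] pos that tI by force
        then show ?thesis using i False
          by (intro exI[of _ "Suc i"]) (auto simp: s_def closed_segment_eq_real_ivl)
      next
        case 2
        then have down: "poly (?G \<sigma>) x > 0" if "x \<in> {z i - d..t}" for x
          using anti_mono_poly_Icc[of "z i - d" "z i + d" "?G \<sigma>" x t] pos that tI by force
        show ?thesis
        proof (cases "i = 0")
          case True
          then show ?thesis using down tI
            by (intro exI[of _ 0]) (auto simp: s_def closed_segment_eq_real_ivl)
        next
          case False
          then have lt: "z (i - 1) + d < z i - d" using d3[of "i - 1" i] i by auto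
          have "poly (?G \<sigma>) x > 0" if "x \<in> {z (i - 1) + d..z i - d}" for x
          proof (rule gap[OF \<sigma> down[of "z i - d"], of "z (i - 1) + d" "z i - d"])
            fix j assume "j < k"
            show "z j + d \<le> z (i - 1) + d \<or> z i - d \<le> z j - d"
              using z_le[of j "i - 1"] z_le[of i j] \<open>j < k\<close> i by (cases "j < i") auto
          next
            have "i - 1 < k" using i(1) by simp
            then show "\<tau> \<le> z (i - 1) + d" using \<tau>(2) z_le[of 0 "i - 1"] i(1) d(1) by auto
          qed (use tI lt that in auto)
          then have "poly (?G \<sigma>) x > 0" if "x \<in> {z (i - 1) + d..t}" for x
            using down[of x] that by (cases "x \<le> z i - d") auto
          then show ?thesis using i False tI lt
            by (intro exI[of _ i]) (auto simp: s_def closed_segment_eq_real_ivl)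
        qed
      qed
    qed
  qed
  \<comment> \<open>A zero lies within \<open>d\<close> of some \<open>z i\<close>, where
    \<open>near\<close> applies, or below \<open>\<tau>\<close>, where \<open>zero2\<close> forces
    \<open>\<sigma> = 1\<close> and \<open>zero1\<close> applies.\<close>
  have regular: "poly (pderiv (?G \<sigma>)) t \<noteq> 0"
    if t: "t > 0" and \<sigma>: "\<sigma> \<in> {1, -1}" and zero: "poly (?G \<sigma>) t = 0" for t \<sigma>
  proof (cases "\<exists>i<k. t \<in> {z i - d..z i + d}")
    case True
    then show ?thesis using near[of _ t \<sigma>] \<sigma> by fastforce
  next
    case False
    then have "\<bar>t - z i\<bar> \<ge> d" if "i < k" for i using that by force
    then have "t < \<tau>" using far(2)[of t \<sigma>] zero \<sigma> by force
    moreover have "\<sigma> = 1" using zero2[OF t] zero \<sigma> \<open>t < \<tau>\<close> \<tau>(2) by auto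
    ultimately show ?thesis using zero1[of t] t by simp
  qed
  show thesis
    by (rule that[OF \<epsilon>(1) \<delta>(1) A s_mono _ s_sign regular seg]) (use s_tau[of 0] \<tau>(1) in auto)
qed

end

section \<open>Eigenfunctions in polar form\<close>

text \<open>Each monomial is bounded by one term of the exponential series. The rate 1/4 is half the
  rate of the Gaussian factor \<open>exp (- t / 2)\<close>, so the product still decays like
  \<open>exp (- t / 4)\<close>.\<close>

lemma poly_abs_le_exp:
  fixes p :: "real poly"
  obtains C where "\<And>t. t \<ge> 0 \<Longrightarrow> \<bar>poly p t\<bar> \<le> C * exp (t / 4)"
proof
  fix t :: real assume t: "t \<ge> 0"
  have pow: "t ^ i \<le> fact i * 4 ^ i * exp (t / 4)" for i
  proof -
    have "(t / 4) ^ i / fact i \<le> (\<Sum>n\<in>{i}. inverse (fact n) * (t / 4) ^ n)"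
      by (simp add: field_simps)
    also have "\<dots> \<le> (\<Sum>n. inverse (fact n) * (t / 4) ^ n)"
      using t summable_exp[of "t / 4"] by (intro sum_le_suminf) auto
    also have "\<dots> = exp (t / 4)" by (simp add: exp_def scaleR_conv_of_real)
    finally show ?thesis by (simp add: field_simps power_divide)
  qed
  have "\<bar>poly p t\<bar> \<le> (\<Sum>i\<le>degree p. \<bar>coeff p i\<bar> * t ^ i)"
    unfolding poly_altdef using t
    by (intro order.trans[OF sum_abs]) (simp add: abs_mult power_abs)
  also have "\<dots> \<le> (\<Sum>i\<le>degree p. \<bar>coeff p i\<bar> * (fact i * 4 ^ i * exp (t / 4)))"
    using pow by (intro sum_mono mult_left_mono) auto
  also have "\<dots> = (\<Sum>i\<le>degree p. \<bar>coeff p i\<bar> * (fact i * 4 ^ i)) * exp (t / 4)"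
    by (simp add: sum_distrib_left sum_distrib_right mult_ac)
  finally show "\<bar>poly p t\<bar> \<le> (\<Sum>i\<le>degree p. \<bar>coeff p i\<bar> * (fact i * 4 ^ i)) * exp (t / 4)" .
qed

text \<open>The Gaussian is the product over the coordinates of one-dimensional normal densities, up
  to constants.\<close>

lemma integrable_exp_neg_norm_squared:
  "integrable lborel (\<lambda>v::'a::euclidean_space. exp (- (norm v)\<^sup>2 / 2))"
proof -
  have one: "integrable lborel (\<lambda>x::real. exp (- x\<^sup>2 / 2))"
  proof -
    have "integrable lborel (\<lambda>x. sqrt (2 * pi) * std_normal_density x)"
      by (intro integrable_mult_right) simp
    then show ?thesis by (simp add: std_normal_density_def)
  qed
  interpret product_sigma_finite "\<lambda>_::'a. lborel :: real measure" ..
  have norm_sum: "(norm (\<Sum>b\<in>Basis. f b *\<^sub>R b :: 'a))\<^sup>2 = (\<Sum>b\<in>Basis. (f b)\<^sup>2)" for f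
    by (subst norm_sum_Pythagorean)
      (auto simp: pairwise_def orthogonal_def inner_Basis power_mult_distrib)
  have "integrable (\<Pi>\<^sub>M b\<in>Basis. lborel) (\<lambda>f. \<Prod>b\<in>(Basis :: 'a set). exp (- (f b)\<^sup>2 / (2 :: real)))"
    by (intro product_integrable_prod one finite_Basis)
  then show ?thesis
    by (subst lborel_eq, subst integrable_distr_eq)
      (simp_all add: norm_sum sum_negf sum_divide_distrib flip: exp_sum)
qed

section \<open>The plane as complex numbers, and derivatives in coordinates\<close>

definition to_complex :: "real ^ 2 \<Rightarrow> complex" where
  "to_complex v = Complex (v $ 1) (v $ 2)"

lemma norm_to_complex: "cmod (to_complex v) = norm v"
  by (simp add: to_complex_def cmod_def norm_vec_def L2_set_def sum_2)

lemma norm_vec2_squared: "(norm (v :: real ^ 2))\<^sup>2 = (v $ 1)\<^sup>2 + (v $ 2)\<^sup>2"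
  by (simp add: norm_vec_def L2_set_def sum_2)

lemma has_derivative_to_complex: "(to_complex has_derivative to_complex) F"
proof -
  have "bounded_linear to_complex"
    by (rule bounded_linear_intro[where K = 1])
      (auto simp: norm_to_complex, auto simp: to_complex_def complex_eq_iff)
  then show ?thesis by (rule bounded_linear_imp_has_derivative)
qed

lemma continuous_on_to_complex [continuous_intros]: "continuous_on S to_complex"
  using has_derivative_to_complex has_derivative_continuous
  by (metis continuous_at_imp_continuous_on)

text \<open>One fixed shape for all derivatives, so that partial derivatives can be read off as
  coefficients and second derivatives follow from the product rule.\<close>

abbreviation gradient_form :: "real \<Rightarrow> real \<Rightarrow> real ^ 2 \<Rightarrow> real" where
  "gradient_form a b \<equiv> \<lambda>h. a * h $ 1 + b * h $ 2"

lemma gradient_form_mult: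
  assumes "(f has_derivative gradient_form a b) (at v)" "(g has_derivative gradient_form c d) (at v)"
  shows "((\<lambda>v. f v * g v) has_derivative gradient_form (f v * c + a * g v) (f v * d + b * g v)) (at v)"
  by (rule has_derivative_eq_rhs[OF has_derivative_mult[OF assms]]) (auto simp: algebra_simps)

lemma gradient_form_lincomb:
  fixes p q :: real
  assumes "(f has_derivative gradient_form a b) (at v)" "(g has_derivative gradient_form c d) (at v)"
  shows "((\<lambda>v. p * f v + q * g v) has_derivative gradient_form (p * a + q * c) (p * b + q * d)) (at v)"
  by (rule has_derivative_eq_rhs[OF has_derivative_add[OF
        has_derivative_mult_right[OF assms(1)] has_derivative_mult_right[OF assms(2)]]])
     (auto simp: algebra_simps)

lemma gradient_form_eq:
  assumes "(f has_derivative gradient_form a b) (at v)" "a = a'" "b = b'" "\<And>w. f w = g w"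
  shows "(g has_derivative gradient_form a' b') (at v)"
proof -
  have "g = f" using assms(4) by auto
  then show ?thesis using assms(1-3) by simp
qed

lemma has_derivative_power_to_complex:
  "((\<lambda>v. to_complex v ^ m) has_derivative
      (\<lambda>h. of_nat m * (to_complex h * to_complex v ^ (m - 1)))) (at v)"
  by (rule has_derivative_eq_rhs[OF has_derivative_power[OF has_derivative_to_complex]])
     (auto simp: mult_ac)

text \<open>The real part of \<open>m * z ^ (m - 1) * (h1 + i * h2)\<close>. At \<open>m = 0\<close>
  the truncated exponent is harmless because of the factor \<open>m\<close>.\<close>

lemma has_derivative_Re_power:
  "((\<lambda>v. Re (to_complex v ^ m)) has_derivative
     gradient_form (real m * Re (to_complex v ^ (m - 1))) (- (real m * Im (to_complex v ^ (m - 1))))) (at v)"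
  by (rule has_derivative_eq_rhs[OF has_derivative_Re[OF has_derivative_power_to_complex]])
     (auto simp: to_complex_def algebra_simps)

lemma has_derivative_Im_power:
  "((\<lambda>v. Im (to_complex v ^ m)) has_derivative
     gradient_form (real m * Im (to_complex v ^ (m - 1))) (real m * Re (to_complex v ^ (m - 1)))) (at v)"
  by (rule has_derivative_eq_rhs[OF has_derivative_Im[OF has_derivative_power_to_complex]])
     (auto simp: to_complex_def algebra_simps)

lemma has_derivative_radial:
  assumes "\<And>t. (p has_real_derivative p' t) (at t)"
  shows "((\<lambda>v::real^2. p ((v $ 1)\<^sup>2 + (v $ 2)\<^sup>2)) has_derivative
     gradient_form (2 * v $ 1 * p' ((v $ 1)\<^sup>2 + (v $ 2)\<^sup>2)) (2 * v $ 2 * p' ((v $ 1)\<^sup>2 + (v $ 2)\<^sup>2))) (at v)"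
proof -
  have "((\<lambda>v::real^2. (v $ 1)\<^sup>2 + (v $ 2)\<^sup>2) has_derivative (\<lambda>h. 2 * v $ 1 * h $ 1 + 2 * v $ 2 * h $ 2)) (at v)"
    by (auto intro!: derivative_eq_intros bounded_linear_imp_has_derivative bounded_linear_vec_nth)
  from DERIV_compose_FDERIV[OF assms this] show ?thesis
    by (rule has_derivative_eq_rhs) (auto simp: algebra_simps)
qed

text \<open>Unlike \<open>is_eigenfunction\<close>, this admits the zero function and is therefore
  closed under linear combinations, with derivatives combined termwise. The Gaussian bound yields
  square integrability.\<close>

definition oscillator_mode_data where
  "oscillator_mode_data ev f fx fy fxx fxy fyy C \<longleftrightarrow>
     (\<forall>v. (f has_derivative gradient_form (fx v) (fy v)) (at v)) \<and>
     (\<forall>v. (fx has_derivative gradient_form (fxx v) (fxy v)) (at v)) \<and>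
     (\<forall>v. (fy has_derivative gradient_form (fxy v) (fyy v)) (at v)) \<and>
     continuous_on UNIV fxx \<and> continuous_on UNIV fxy \<and> continuous_on UNIV fyy \<and>
     (\<forall>v. - (fxx v + fyy v) + (norm v)\<^sup>2 * f v = ev * f v) \<and>
     (\<forall>v. \<bar>f v\<bar> \<le> C * exp (- (norm v)\<^sup>2 / 4))"

definition oscillator_mode :: "real \<Rightarrow> (real ^ 2 \<Rightarrow> real) \<Rightarrow> bool" where
  "oscillator_mode ev f \<longleftrightarrow> (\<exists>fx fy fxx fxy fyy C. oscillator_mode_data ev f fx fy fxx fxy fyy C)"

lemma oscillator_mode_linear_combination:
  assumes "oscillator_mode ev f" "oscillator_mode ev g"
  shows "oscillator_mode ev (\<lambda>v. a * f v + b * g v)"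
proof -
  obtain fx fy fxx fxy fyy C where "oscillator_mode_data ev f fx fy fxx fxy fyy C"
    using assms(1) unfolding oscillator_mode_def by blast
  then have f:
    "\<And>v. (f has_derivative gradient_form (fx v) (fy v)) (at v)"
    "\<And>v. (fx has_derivative gradient_form (fxx v) (fxy v)) (at v)"
    "\<And>v. (fy has_derivative gradient_form (fxy v) (fyy v)) (at v)"
    "continuous_on UNIV fxx" "continuous_on UNIV fxy" "continuous_on UNIV fyy"
    "\<And>v. - (fxx v + fyy v) + (norm v)\<^sup>2 * f v = ev * f v"
    "\<And>v. \<bar>f v\<bar> \<le> C * exp (- (norm v)\<^sup>2 / 4)"
    by (simp_all only: oscillator_mode_data_def simp_thms)
  obtain gx gy gxx gxy gyy D where "oscillator_mode_data ev g gx gy gxx gxy gyy D"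
    using assms(2) unfolding oscillator_mode_def by blast
  then have g:
    "\<And>v. (g has_derivative gradient_form (gx v) (gy v)) (at v)"
    "\<And>v. (gx has_derivative gradient_form (gxx v) (gxy v)) (at v)"
    "\<And>v. (gy has_derivative gradient_form (gxy v) (gyy v)) (at v)"
    "continuous_on UNIV gxx" "continuous_on UNIV gxy" "continuous_on UNIV gyy"
    "\<And>v. - (gxx v + gyy v) + (norm v)\<^sup>2 * g v = ev * g v"
    "\<And>v. \<bar>g v\<bar> \<le> D * exp (- (norm v)\<^sup>2 / 4)"
    by (simp_all only: oscillator_mode_data_def simp_thms)
  have "oscillator_mode_data ev (\<lambda>v. a * f v + b * g v) (\<lambda>v. a * fx v + b * gx v)
     (\<lambda>v. a * fy v + b * gy v) (\<lambda>v. a * fxx v + b * gxx v) (\<lambda>v. a * fxy v + b * gxy v)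
     (\<lambda>v. a * fyy v + b * gyy v) (\<bar>a\<bar> * C + \<bar>b\<bar> * D)"
    unfolding oscillator_mode_data_def
  proof (intro conjI allI)
    fix v
    show "((\<lambda>v. a * f v + b * g v) has_derivative
        gradient_form (a * fx v + b * gx v) (a * fy v + b * gy v)) (at v)"
      by (rule gradient_form_lincomb[OF f(1) g(1)])
    show "((\<lambda>v. a * fx v + b * gx v) has_derivative
        gradient_form (a * fxx v + b * gxx v) (a * fxy v + b * gxy v)) (at v)"
      by (rule gradient_form_lincomb[OF f(2) g(2)])
    show "((\<lambda>v. a * fy v + b * gy v) has_derivative
        gradient_form (a * fxy v + b * gxy v) (a * fyy v + b * gyy v)) (at v)"
      by (rule gradient_form_lincomb[OF f(3) g(3)])
    have "- ((a * fxx v + b * gxx v) + (a * fyy v + b * gyy v)) + (norm v)\<^sup>2 * (a * f v + b * g v)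
        = a * (- (fxx v + fyy v) + (norm v)\<^sup>2 * f v) + b * (- (gxx v + gyy v) + (norm v)\<^sup>2 * g v)"
      by (simp add: algebra_simps)
    then show "- ((a * fxx v + b * gxx v) + (a * fyy v + b * gyy v)) + (norm v)\<^sup>2 * (a * f v + b * g v)
        = ev * (a * f v + b * g v)"
      by (simp only: f(7) g(7)) (simp add: algebra_simps)
    have "\<bar>a * f v + b * g v\<bar> \<le> \<bar>a\<bar> * \<bar>f v\<bar> + \<bar>b\<bar> * \<bar>g v\<bar>"
      using abs_triangle_ineq[of "a * f v" "b * g v"] by (simp add: abs_mult)
    also have "\<dots> \<le> \<bar>a\<bar> * (C * exp (- (norm v)\<^sup>2 / 4)) + \<bar>b\<bar> * (D * exp (- (norm v)\<^sup>2 / 4))"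
      by (intro add_mono mult_left_mono f(8) g(8)) auto
    finally show "\<bar>a * f v + b * g v\<bar> \<le> (\<bar>a\<bar> * C + \<bar>b\<bar> * D) * exp (- (norm v)\<^sup>2 / 4)"
      by (simp add: algebra_simps)
  qed (intro continuous_intros f(4-6) g(4-6))+
  then show ?thesis unfolding oscillator_mode_def by blast
qed

lemma partial_derivative_vec2:
  fixes f :: "real ^ 2 \<Rightarrow> real"
  assumes "\<And>v. (f has_derivative gradient_form (fx v) (fy v)) (at v)"
  shows "partial_derivative (axis 1 1) f = fx" "partial_derivative (axis 2 1) f = fy"
  by (auto simp: partial_derivative_def frechet_derivative_at[OF assms, symmetric] axis_def)

lemma oscillator_mode_eigenfunction:
  assumes "oscillator_mode ev f" "f x \<noteq> 0"
  shows "is_eigenfunction ev f"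
proof -
  obtain fx fy fxx fxy fyy C where "oscillator_mode_data ev f fx fy fxx fxy fyy C"
    using assms(1) unfolding oscillator_mode_def by blast
  then have f:
    "\<And>v. (f has_derivative gradient_form (fx v) (fy v)) (at v)"
    "\<And>v. (fx has_derivative gradient_form (fxx v) (fxy v)) (at v)"
    "\<And>v. (fy has_derivative gradient_form (fxy v) (fyy v)) (at v)"
    "continuous_on UNIV fxx" "continuous_on UNIV fxy" "continuous_on UNIV fyy"
    "\<And>v. - (fxx v + fyy v) + (norm v)\<^sup>2 * f v = ev * f v"
    "\<And>v. \<bar>f v\<bar> \<le> C * exp (- (norm v)\<^sup>2 / 4)"
    by (simp_all only: oscillator_mode_data_def simp_thms)
  note pd = partial_derivative_vec2[of f, OF f(1)] partial_derivative_vec2[of fx, OF f(2)]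
    partial_derivative_vec2[of fy, OF f(3)]
  have Basis2: "(Basis :: (real ^ 2) set) = {axis 1 1, axis 2 1}"
    by (auto simp: Basis_vec_def UNIV_2)
  have "twice_cont_differentiable f"
    unfolding twice_cont_differentiable_def Basis2
    using f by (auto simp: pd differentiable_def)
  moreover have "harmonic_oscillator f v = ev * f v" for v
    using f(7)[of v] by (simp add: harmonic_oscillator_def laplacian_def Basis2 axis_eq_axis pd)
  moreover have "square_integrable f"
    unfolding square_integrable_def
  proof
    have "continuous_on UNIV f"
      using f(1) by (meson continuous_at_imp_continuous_on has_derivative_continuous)
    then show meas: "f \<in> borel_measurable lborel"
      by (simp add: borel_measurable_continuous_onI)
    show "integrable lborel (\<lambda>v. (f v)\<^sup>2)"
    proof (rule Bochner_Integration.integrable_bound)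
      show "integrable lborel (\<lambda>v::real^2. C\<^sup>2 * exp (- (norm v)\<^sup>2 / 2))"
        by (intro integrable_mult_right integrable_exp_neg_norm_squared)
      show "(\<lambda>v. (f v)\<^sup>2) \<in> borel_measurable lborel" using meas by measurable
      have "(f v)\<^sup>2 \<le> C\<^sup>2 * exp (- (norm v)\<^sup>2 / 2)" for v
      proof -
        have "\<bar>f v\<bar>\<^sup>2 \<le> (C * exp (- (norm v)\<^sup>2 / 4))\<^sup>2" by (intro power_mono f(8)) simp
        also have "\<dots> = C\<^sup>2 * exp (- (norm v)\<^sup>2 / 2)"
          by (simp add: power_mult_distrib flip: exp_double)
        finally show ?thesis by simp
      qed
      then show "AE v in lborel. norm ((f v)\<^sup>2) \<le> norm (C\<^sup>2 * exp (- (norm v)\<^sup>2 / 2))" by simp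
    qed
  qed
  ultimately show ?thesis using assms(2) by (auto simp: is_eigenfunction_def)
qed

text \<open>Separation of variables. For a radial factor \<open>p\<close> and the harmonic
  homogeneous factor \<open>Re (z ^ m)\<close>, the Laplacian is
  \<open>4 * (s * p'' + (m + 1) * p')\<close> times that factor. With
  \<open>p = q * exp (- t / 2)\<close> the Laguerre equation makes this
  \<open>s - 2 * (2 * n + m + 1)\<close> times the function.\<close>

lemma polar_mode:
  assumes ode: "\<And>t. t * poly (pderiv (pderiv q)) t + (real m + 1 - t) * poly (pderiv q) t
      + real n * poly q t = 0"
  shows "oscillator_mode (2 * (real (2 * n + m) + 1))
     (\<lambda>v. poly q ((norm v)\<^sup>2) * exp (- (norm v)\<^sup>2 / 2) * Re (to_complex v ^ m))"
proof -
  define p where "p t = poly q t * exp (- t / 2)" for t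
  define p' where "p' t = (poly (pderiv q) t - poly q t / 2) * exp (- t / 2)" for t
  define p'' where "p'' t = (poly (pderiv (pderiv q)) t - poly (pderiv q) t + poly q t / 4) * exp (- t / 2)" for t
  have p: "(p has_real_derivative p' t) (at t)" for t
    unfolding p_def p'_def by (auto intro!: derivative_eq_intros poly_DERIV simp: field_simps)
  have p': "(p' has_real_derivative p'' t) (at t)" for t
    unfolding p'_def p''_def by (auto intro!: derivative_eq_intros poly_DERIV simp: field_simps)
  define s where "s v = (v $ 1)\<^sup>2 + (v $ 2)\<^sup>2" for v :: "real ^ 2"
  define R where "R i v = Re (to_complex v ^ i)" for i v
  define I where "I i v = Im (to_complex v ^ i)" for i v
  \<comment> \<open>Here and in the index \<open>m - 2\<close> the truncated subtraction is
    harmless: \<open>m1\<close> occurs only next to the factor \<open>m\<close>, and the index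
    \<open>m - 2\<close> only next to \<open>m * m1\<close>.\<close>
  define m1 where "m1 = real (m - 1)"
  note dR = has_derivative_Re_power[folded R_def I_def]
  note dI = has_derivative_Im_power[folded R_def I_def]
  note dp = has_derivative_radial[of p, OF p, folded s_def]
  note dp' = has_derivative_radial[of p', OF p', folded s_def]
  have dx: "((\<lambda>v::real^2. v $ 1) has_derivative gradient_form 1 0) (at v)"
    "((\<lambda>v::real^2. v $ 2) has_derivative gradient_form 0 1) (at v)" for v
    by (simp_all add: bounded_linear_imp_has_derivative bounded_linear_vec_nth)
  have cp: "continuous_on UNIV (\<lambda>v. p (s v))" "continuous_on UNIV (\<lambda>v. p' (s v))"
    "continuous_on UNIV (\<lambda>v. p'' (s v))"
    unfolding p_def p'_def p''_def s_def by (auto intro!: continuous_intros)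
  have cR: "continuous_on UNIV (R i)" "continuous_on UNIV (I i)" for i
    unfolding R_def I_def by (auto intro!: continuous_intros)
  define f where "f v = p (s v) * R m v" for v
  define fx where "fx v = 2 * v $ 1 * p' (s v) * R m v + real m * p (s v) * R (m - 1) v" for v
  define fy where "fy v = 2 * v $ 2 * p' (s v) * R m v - real m * p (s v) * I (m - 1) v" for v
  define fxx where "fxx v = 2 * p' (s v) * R m v + 4 * (v $ 1)\<^sup>2 * p'' (s v) * R m v
     + 4 * real m * v $ 1 * p' (s v) * R (m - 1) v + real m * m1 * p (s v) * R (m - 2) v" for v
  define fxy where "fxy v = 4 * v $ 1 * v $ 2 * p'' (s v) * R m v - 2 * real m * v $ 1 * p' (s v) * I (m - 1) v
     + 2 * real m * v $ 2 * p' (s v) * R (m - 1) v - real m * m1 * p (s v) * I (m - 2) v" for v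
  define fyy where "fyy v = 2 * p' (s v) * R m v + 4 * (v $ 2)\<^sup>2 * p'' (s v) * R m v
     - 4 * real m * v $ 2 * p' (s v) * I (m - 1) v - real m * m1 * p (s v) * R (m - 2) v" for v
  have 2: "m - 1 - 1 = m - 2" by simp
  have d0: "(f has_derivative gradient_form (fx v) (fy v)) (at v)" for v
    by (rule gradient_form_eq[OF gradient_form_mult[OF dp dR[of m]]])
       (simp_all add: f_def fx_def fy_def algebra_simps)
  have d1: "(fx has_derivative gradient_form (fxx v) (fxy v)) (at v)" for v
    by (rule gradient_form_eq[OF gradient_form_lincomb[of _ _ _ _ _ _ _ 2 "real m",
          OF gradient_form_mult[OF gradient_form_mult[OF dx(1) dp'] dR[of m]] gradient_form_mult[OF dp dR[of "m - 1"]]]])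
       (simp_all add: fx_def fxx_def fxy_def algebra_simps power2_eq_square m1_def numeral_2_eq_2)
  have d2: "(fy has_derivative gradient_form (fxy v) (fyy v)) (at v)" for v
    by (rule gradient_form_eq[OF gradient_form_lincomb[of _ _ _ _ _ _ _ 2 "- real m",
          OF gradient_form_mult[OF gradient_form_mult[OF dx(2) dp'] dR[of m]] gradient_form_mult[OF dp dI[of "m - 1"]]]])
       (simp_all add: fy_def fyy_def fxy_def algebra_simps power2_eq_square m1_def numeral_2_eq_2)
  have cont: "continuous_on UNIV fxx" "continuous_on UNIV fxy" "continuous_on UNIV fyy"
    unfolding fxx_def fxy_def fyy_def by (intro continuous_intros cp cR)+
  have eq: "- (fxx v + fyy v) + (norm v)\<^sup>2 * f v = (2 * (real (2 * n + m) + 1)) * f v" for v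
  proof -
    \<comment> \<open>Euler's identity for a homogeneous polynomial of degree \<open>m\<close>; the
      factor \<open>m\<close> covers the case \<open>m = 0\<close>.\<close>
    have euler: "real m * (v $ 1 * R (m - 1) v - v $ 2 * I (m - 1) v) = real m * R m v"
    proof (cases m)
      case (Suc i)
      have "R (Suc i) v = v $ 1 * R i v - v $ 2 * I i v"
        by (simp add: R_def I_def to_complex_def)
      then show ?thesis using Suc by simp
    qed simp
    have "fxx v + fyy v = 4 * p' (s v) * R m v + 4 * s v * p'' (s v) * R m v
        + 4 * p' (s v) * (real m * (v $ 1 * R (m - 1) v - v $ 2 * I (m - 1) v))"
      by (simp add: fxx_def fyy_def s_def algebra_simps)
    also have "\<dots> = 4 * (s v * p'' (s v) + (real m + 1) * p' (s v)) * R m v"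
      unfolding euler by (simp add: algebra_simps)
    also have "s v * p'' (s v) + (real m + 1) * p' (s v) =
      ((s v * poly (pderiv (pderiv q)) (s v) + (real m + 1 - s v) * poly (pderiv q) (s v)
        + real n * poly q (s v)) + (s v / 4 - (real m + 1) / 2 - real n) * poly q (s v)) * exp (- s v / 2)"
      by (simp add: p'_def p''_def algebra_simps)
    also have "\<dots> = (s v / 4 - (real m + 1) / 2 - real n) * p (s v)"
      by (simp only: ode p_def add_0_left mult.assoc)
    finally have laplace: "fxx v + fyy v = 4 * ((s v / 4 - (real m + 1) / 2 - real n) * p (s v)) * R m v" .
    have "(norm v)\<^sup>2 = s v" by (simp add: norm_vec2_squared s_def)
    then show ?thesis unfolding laplace f_def by (simp add: field_simps)
  qed
  \<comment> \<open>For odd \<open>m\<close> the bound \<open>norm v ^ m\<close> on the angular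
    factor is not a polynomial in the squared norm; it is replaced by
    \<open>1 + s ^ m\<close>.\<close>
  obtain C where C: "\<And>t. t \<ge> 0 \<Longrightarrow> \<bar>poly (q * (1 + monom 1 m)) t\<bar> \<le> C * exp (t / 4)"
      using poly_abs_le_exp by blast
    have bound: "\<bar>f v\<bar> \<le> C * exp (- (norm v)\<^sup>2 / 4)" for v
    proof -
      have s_nonneg: "s v \<ge> 0" by (simp add: s_def)
      have "\<bar>R m v\<bar> \<le> norm v ^ m"
        unfolding R_def using abs_Re_le_cmod[of "to_complex v ^ m"] by (simp add: norm_power norm_to_complex)
      also have "norm v ^ m \<le> 1 + norm v ^ m * norm v ^ m"
      proof -
        have "0 \<le> (norm v ^ m - 1)\<^sup>2 + norm v ^ m" by (intro add_nonneg_nonneg) auto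
        then show ?thesis by (simp add: power2_eq_square algebra_simps)
      qed
      also have "\<dots> = 1 + s v ^ m"
        by (simp add: s_def flip: norm_vec2_squared power_mult power_add mult_2)
      finally have "\<bar>f v\<bar> \<le> \<bar>poly q (s v)\<bar> * exp (- s v / 2) * (1 + s v ^ m)"
        unfolding f_def p_def by (simp add: abs_mult mult_left_mono)
      also have "\<dots> = \<bar>poly (q * (1 + monom 1 m)) (s v)\<bar> * exp (- s v / 2)"
        using s_nonneg by (simp add: poly_monom abs_mult)
      also have "\<dots> \<le> C * exp (s v / 4) * exp (- s v / 2)"
        by (intro mult_right_mono C) (auto simp: s_def)
      also have "\<dots> = C * exp (- (norm v)\<^sup>2 / 4)"
      proof -
        have "(norm v)\<^sup>2 = s v" by (simp add: norm_vec2_squared s_def)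
        then show ?thesis by (simp add: mult.assoc flip: exp_add)
      qed
      finally show ?thesis .
    qed
  have "f = (\<lambda>v. poly q ((norm v)\<^sup>2) * exp (- (norm v)\<^sup>2 / 2) * Re (to_complex v ^ m))"
    by (auto simp: f_def p_def s_def R_def norm_vec2_squared)
  moreover have "oscillator_mode_data (2 * (real (2 * n + m) + 1)) f fx fy fxx fxy fyy C"
    unfolding oscillator_mode_data_def using d0 d1 d2 cont eq bound by blast
  ultimately show ?thesis unfolding oscillator_mode_def by blast
qed

section \<open>Counting the nodal domains\<close>

lemma connected_no_zero_same_sign:
  fixes f :: "'a::topological_space \<Rightarrow> real"
  assumes "connected T" "continuous_on T f" "\<And>x. x \<in> T \<Longrightarrow> f x \<noteq> 0"
    and "x \<in> T" "y \<in> T" "f x > 0"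
  shows "f y > 0"
proof (rule ccontr)
  assume "\<not> f y > 0"
  then have "0 \<in> f ` T"
    using connectedD_interval[OF connected_continuous_image[OF assms(2,1)], of "f y" "f x" 0] assms(4-6)
    by auto
  then show False using assms(3) by auto
qed

definition polar :: "real \<Rightarrow> real \<Rightarrow> real ^ 2" where
  "polar t \<theta> = sqrt t *\<^sub>R (cos \<theta> *\<^sub>R axis 1 1 + sin \<theta> *\<^sub>R axis 2 1)"

lemma polar_nth [simp]: "polar t \<theta> $ 1 = sqrt t * cos \<theta>" "polar t \<theta> $ 2 = sqrt t * sin \<theta>"
  by (simp_all add: polar_def axis_def)

lemma to_complex_polar: "to_complex (polar t \<theta>) = rcis (sqrt t) \<theta>"
  by (simp add: to_complex_def complex_eq_iff rcis_def)

lemma norm_polar_squared: "t \<ge> 0 \<Longrightarrow> (norm (polar t \<theta>))\<^sup>2 = t"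
  by (simp add: norm_vec2_squared power_mult_distrib flip: distrib_left)

lemma polar_exists:
  obtains t \<theta> where "t \<ge> 0" "v = polar t \<theta>"
proof
  let ?z = "to_complex v"
  have "?z = rcis (cmod ?z) (Arg ?z)" by (simp add: rcis_cmod_Arg)
  then have "to_complex v = to_complex (polar ((cmod ?z)\<^sup>2) (Arg ?z))"
    by (simp add: to_complex_polar)
  then have "v $ i = polar ((cmod ?z)\<^sup>2) (Arg ?z) $ i" for i
    using exhaust_2[of i] by (auto simp: to_complex_def)
  then show "v = polar ((cmod ?z)\<^sup>2) (Arg ?z)" by (simp add: vec_eq_iff)
qed simp

lemma polar_zero [simp]: "polar 0 \<theta> = 0"
  by (simp add: polar_def)

lemma polar_cong: "cos \<theta> = cos \<theta>' \<Longrightarrow> sin \<theta> = sin \<theta>' \<Longrightarrow> polar t \<theta> = polar t \<theta>'"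
  by (simp add: polar_def)

lemma cos_add_int_pi: "cos (of_int m * pi + b) = cos (of_int m * pi) * cos b"
  by (simp add: cos_add sin_zero_iff_int2)

lemma cos_int_pi_cases: "cos (of_int m * pi) \<in> {1, -1::real}"
proof -
  have "sin (of_int m * pi) = 0" by (simp add: sin_zero_iff_int2)
  then have "(cos (of_int m * pi))\<^sup>2 = 1" using sin_cos_squared_add[of "of_int m * pi"] by simp
  then show ?thesis by (simp add: power2_eq_1_iff)
qed

text \<open>Applied to \<open>n * \<theta>\<close>: the integer selects a sector between adjacent
  rays with \<open>cos (n * \<theta>) = 0\<close>, and \<open>a\<close> measures the offset from its
  central ray, where the cosine is 1 or -1.\<close>

lemma nearest_int_pi:
  obtains m :: int and a where "x = of_int m * pi + a" "\<bar>a\<bar> \<le> pi / 2"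
proof -
  let ?m = "round (x / pi)"
  have "\<bar>of_int ?m - x / pi\<bar> \<le> 1 / 2" by (rule of_int_round_abs_le)
  then have "\<bar>of_int ?m - x / pi\<bar> * pi \<le> 1 / 2 * pi" by (intro mult_right_mono) auto
  also have "\<bar>of_int ?m - x / pi\<bar> * pi = \<bar>(of_int ?m - x / pi) * pi\<bar>" by (simp add: abs_mult)
  also have "(of_int ?m - x / pi) * pi = - (x - of_int ?m * pi)" by (simp add: field_simps)
  finally have "\<bar>x - of_int ?m * pi\<bar> \<le> pi / 2" unfolding abs_minus_cancel by simp
  then show thesis using that[of ?m "x - of_int ?m * pi"] by simp
qed

lemma cos_mono_abs: "\<bar>b\<bar> \<le> \<bar>a\<bar> \<Longrightarrow> \<bar>a\<bar> \<le> pi \<Longrightarrow> cos a \<le> cos b"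
  using cos_monotone_0_pi_le[of "\<bar>b\<bar>" "\<bar>a\<bar>"] by simp

text \<open>The values \<open>A + \<sigma> * B + C\<close> are those on the rays where the cosine is
  1 or -1, that is, the ray polynomials. The assumptions on \<open>s\<close> are conclusions of
  \<open>perturbation\<close>; its positivity statement becomes \<open>A_neg\<close>.\<close>

locale polar_quadratic =
  fixes n k :: nat and W :: "real ^ 2 \<Rightarrow> real" and A B C :: "real \<Rightarrow> real" and s :: "nat \<Rightarrow> real"
  assumes n: "n \<ge> 1"
    and W_cont: "continuous_on UNIV W"
    and W_polar: "t \<ge> 0 \<Longrightarrow> W (polar t \<theta>) = A t + B t * cos (real n * \<theta>) + C t * (cos (real n * \<theta>))\<^sup>2"
    and A_neg: "t \<ge> 0 \<Longrightarrow> A t < 0"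
    and C_nonneg: "t \<ge> 0 \<Longrightarrow> C t \<ge> 0"
    and s_mono: "strict_mono_on {..k} s"
    and s_pos: "s 0 > 0"
    and s_sign: "i \<le> k \<Longrightarrow> \<sigma> \<in> {1, -1} \<Longrightarrow> (-1) ^ i * \<sigma> * (A (s i) + \<sigma> * B (s i) + C (s i)) > 0"
    and s_link: "t > 0 \<Longrightarrow> \<sigma> \<in> {1, -1} \<Longrightarrow> A t + \<sigma> * B t + C t > 0 \<Longrightarrow>
       \<exists>i\<le>k. \<forall>x\<in>closed_segment t (s i). A x + \<sigma> * B x + C x > 0"
begin

abbreviation G :: "real \<Rightarrow> real \<Rightarrow> real" where "G \<sigma> t \<equiv> A t + \<sigma> * B t + C t"

lemma s_gt_0: "i \<le> k \<Longrightarrow> s i > 0"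
  using strict_mono_on_leD[OF s_mono, of 0 i] s_pos by auto

text \<open>Convexity of \<open>c \<mapsto> A + B c + C c\<^sup>2\<close> together with \<open>A < 0\<close>: negativity spreads towards
  \<open>c = 0\<close> and positivity spreads away from it.\<close>

lemma quadratic_le:
  assumes "t \<ge> 0" "0 \<le> l" "l \<le> 1"
  shows "A t + B t * (l * c) + C t * (l * c)\<^sup>2 \<le> (1 - l) * A t + l * (A t + B t * c + C t * c\<^sup>2)"
proof -
  have "l\<^sup>2 * (C t * c\<^sup>2) \<le> l * (C t * c\<^sup>2)"
    using assms C_nonneg[OF assms(1)] by (intro mult_right_mono) (auto simp: power2_eq_square mult_left_le)
  then show ?thesis by (simp add: algebra_simps power_mult_distrib)
qed

lemma quadratic_neg:
  assumes "t \<ge> 0" "0 \<le> l" "l \<le> 1" "A t + B t * c + C t * c\<^sup>2 < 0"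
  shows "A t + B t * (l * c) + C t * (l * c)\<^sup>2 < 0"
proof (cases "l = 0")
  case False
  then have "l * (A t + B t * c + C t * c\<^sup>2) < 0" using assms by (intro mult_pos_neg) auto
  moreover have "(1 - l) * A t \<le> 0" using assms A_neg[OF assms(1)] by (intro mult_nonneg_nonpos) auto
  ultimately show ?thesis using quadratic_le[OF assms(1-3), of c] by linarith
qed (use A_neg assms in simp)

lemma quadratic_pos:
  assumes "t \<ge> 0" "0 \<le> l" "l \<le> 1" "A t + B t * (l * c) + C t * (l * c)\<^sup>2 > 0"
  shows "A t + B t * c + C t * c\<^sup>2 > 0"
proof (rule ccontr)
  assume "\<not> ?thesis"
  then have "l * (A t + B t * c + C t * c\<^sup>2) \<le> 0" using assms by (intro mult_nonneg_nonpos) auto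
  moreover have "(1 - l) * A t \<le> 0" using assms A_neg[OF assms(1)] by (intro mult_nonneg_nonpos) auto
  ultimately show False using quadratic_le[OF assms(1-3), of c] assms(4) by linarith
qed

section \<open>Connecting points inside the complement of the zero set\<close>

definition S where "S = {v. W v \<noteq> 0}"

lemma link_image:
  assumes "connected X" "continuous_on X f" "\<And>x. x \<in> X \<Longrightarrow> W (f x) \<noteq> 0" "x \<in> X" "y \<in> X"
  shows "connected_component S (f x) (f y)"
  unfolding connected_component_def
  using assms by (intro exI[of _ "f ` X"]) (auto simp: S_def intro: connected_continuous_image)

lemma link_angle:
  assumes "\<And>\<phi>. \<phi> \<in> closed_segment \<theta> \<theta>' \<Longrightarrow> W (polar t \<phi>) \<noteq> 0"
  shows "connected_component S (polar t \<theta>) (polar t \<theta>')"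
  by (rule link_image[of "closed_segment \<theta> \<theta>'" "polar t"])
    (auto simp: polar_def[abs_def] assms[unfolded polar_def] intro!: continuous_intros)

lemma link_ray:
  assumes "\<And>x. x \<in> closed_segment t t' \<Longrightarrow> W (polar x \<theta>) \<noteq> 0"
  shows "connected_component S (polar t \<theta>) (polar t' \<theta>)"
  by (rule link_image[of "closed_segment t t'" "\<lambda>x. polar x \<theta>"])
    (auto simp: polar_def[abs_def] assms[unfolded polar_def] intro!: continuous_intros)

lemma angle_segment:
  assumes "\<phi> \<in> closed_segment ((of_int m * pi + a) / real n) ((of_int m * pi + a') / real n)"
  obtains b where "real n * \<phi> = of_int m * pi + b" "b \<in> closed_segment a a'"
proof -
  obtain u where u: "0 \<le> u" "u \<le> 1"
    "\<phi> = (1 - u) * ((of_int m * pi + a) / real n) + u * ((of_int m * pi + a') / real n)"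
    using assms by (auto simp: in_segment)
  have "real n * \<phi> = of_int m * pi + ((1 - u) * a + u * a')"
    unfolding u(3) using n by (simp add: field_simps)
  moreover have "(1 - u) * a + u * a' \<in> closed_segment a a'"
    using u by (auto simp: in_segment)
  ultimately show thesis using that by blast
qed

lemma W_zero: "W 0 < 0"
proof -
  \<comment> \<open>At the origin the angle is arbitrary; this one makes the cosine vanish and
    leaves only \<open>A 0\<close>.\<close>
  have "W (polar 0 (pi / 2 / real n)) = A 0" using n by (subst W_polar) auto
  then show ?thesis using A_neg[of 0] by simp
qed

text \<open>Rotate within the sector to a nearest ray with vanishing cosine: the cosine shrinks in
  absolute value, so \<open>quadratic_neg\<close> keeps \<open>W\<close> negative. Then follow that
  ray, where \<open>W = A\<close>, to the origin.\<close>

lemma negative_linked_to_0: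
  assumes "W v < 0"
  shows "connected_component S v 0"
proof -
  obtain t \<theta> where v: "t \<ge> 0" "v = polar t \<theta>" by (rule polar_exists)
  obtain m :: int and a where a: "real n * \<theta> = of_int m * pi + a" "\<bar>a\<bar> \<le> pi / 2"
    by (rule nearest_int_pi)
  define a' where "a' = (if a \<ge> 0 then pi / 2 else - (pi / 2))"
  have a': "cos a' = 0" by (auto simp: a'_def)
  have \<theta>: "\<theta> = (of_int m * pi + a) / real n" using a(1) n by (simp add: field_simps)
  define \<theta>' where "\<theta>' = (of_int m * pi + a') / real n"
  have \<theta>': "cos (real n * \<theta>') = 0" using n a' by (simp add: \<theta>'_def cos_add_int_pi)
  have "connected_component S (polar t \<theta>) (polar t \<theta>')"
  proof (rule link_angle)
    fix \<phi> assume "\<phi> \<in> closed_segment \<theta> \<theta>'"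
    then obtain b where b: "real n * \<phi> = of_int m * pi + b" "b \<in> closed_segment a a'"
      unfolding \<theta> \<theta>'_def by (rule angle_segment)
    have "\<bar>a\<bar> \<le> \<bar>b\<bar>" "\<bar>b\<bar> \<le> pi / 2"
      using b(2) a(2) by (auto simp: a'_def closed_segment_eq_real_ivl split: if_splits)
    then have cb: "0 \<le> cos b" "cos b \<le> cos a" by (auto intro!: cos_ge_zero cos_mono_abs)
    \<comment> \<open>If \<open>cos a = 0\<close>, then \<open>cos b = 0\<close> as well, and the
      default 0 is a valid ratio.\<close>
    define l where "l = (if cos a = 0 then 0 else cos b / cos a)"
    have l: "0 \<le> l" "l \<le> 1" "cos b = l * cos a" using cb by (auto simp: l_def)
    then have "cos (real n * \<phi>) = l * cos (real n * \<theta>)"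
      unfolding a(1) b(1) cos_add_int_pi by simp
    moreover have "A t + B t * cos (real n * \<theta>) + C t * (cos (real n * \<theta>))\<^sup>2 < 0"
      using assms v W_polar by simp
    ultimately have "W (polar t \<phi>) < 0"
      using quadratic_neg[OF v(1) l(1,2)] W_polar[OF v(1)] by simp
    then show "W (polar t \<phi>) \<noteq> 0" by simp
  qed
  moreover have "connected_component S (polar t \<theta>') (polar 0 \<theta>')"
  proof (rule link_ray)
    fix x assume "x \<in> closed_segment t 0"
    then have "x \<ge> 0" using v(1) by (auto simp: closed_segment_eq_real_ivl split: if_splits)
    then show "W (polar x \<theta>') \<noteq> 0" using \<theta>' A_neg[of x] by (simp add: W_polar)
  qed
  ultimately show ?thesis unfolding v(2) using connected_component_trans by fastforce
qed

text \<open>On the circle \<open>t = s i\<close>, \<open>W\<close> is positive on those rays at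
  angle \<open>j * pi / n\<close> for which \<open>j\<close> has the parity of \<open>i\<close>;
  \<open>l < n\<close> numbers them in one full turn.\<close>

definition rep :: "nat \<Rightarrow> nat \<Rightarrow> real ^ 2" where
  "rep i l = polar (s i) (real (2 * l + i mod 2) * pi / real n)"

lemma W_central:
  assumes "t \<ge> 0"
  shows "W (polar t (of_int m * pi / real n)) = G (cos (of_int m * pi)) t"
proof -
  have "(cos (of_int m * pi))\<^sup>2 = (1::real)" using cos_int_pi_cases[of m] by auto
  then show ?thesis using n by (subst W_polar[OF assms]) simp
qed

lemma cos_int_pi: "cos (of_int m * pi) = (if even m then 1 else - 1)"
proof -
  obtain j where "m = 2 * j \<or> m = 2 * j + 1" by (metis oddE evenE)
  then show ?thesis
  proof
    assume "m = 2 * j"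
    then show ?thesis using cos_int_2pin[of j] by (simp add: mult_ac)
  next
    assume "m = 2 * j + 1"
    then have "of_int m * pi = of_int (2 * j) * pi + pi" by (simp add: distrib_right)
    then have "cos (of_int m * pi) = - cos (of_int (2 * j) * pi)" by (simp only: cos_add_int_pi) simp
    then show ?thesis using cos_int_2pin[of j] \<open>m = 2 * j + 1\<close> by (simp add: mult_ac)
  qed
qed

text \<open>Rotate to the central ray of the sector: the cosine grows in absolute value, so
  \<open>quadratic_pos\<close> keeps \<open>W\<close> positive. Then \<open>s_link\<close> leads
  along the ray to some \<open>s i\<close>, and positivity there forces the parity required by
  \<open>rep\<close>.\<close>

lemma positive_linked_to_rep:
  assumes "W v > 0"
  obtains i l where "i \<le> k" "l < n" "connected_component S v (rep i l)"
proof -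
  obtain t \<theta> where v: "t \<ge> 0" "v = polar t \<theta>" by (rule polar_exists)
  have "t \<noteq> 0" using assms v W_zero by auto
  with v have t: "t > 0" by simp
  obtain m :: int and a where a: "real n * \<theta> = of_int m * pi + a" "\<bar>a\<bar> \<le> pi / 2"
    by (rule nearest_int_pi)
  have \<theta>: "\<theta> = (of_int m * pi + a) / real n" using a(1) n by (simp add: field_simps)
  define \<theta>' where "\<theta>' = (of_int m * pi + 0) / real n"
  have Wv: "A t + B t * cos (real n * \<theta>) + C t * (cos (real n * \<theta>))\<^sup>2 > 0"
    using assms v W_polar by simp
  have W_seg: "W (polar t \<phi>) > 0" if \<phi>: "\<phi> \<in> closed_segment \<theta> \<theta>'" for \<phi>
  proof -
    obtain b where b: "real n * \<phi> = of_int m * pi + b" "b \<in> closed_segment a 0"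
      using \<phi> unfolding \<theta> \<theta>'_def by (rule angle_segment)
    have "\<bar>b\<bar> \<le> \<bar>a\<bar>"
      using b(2) by (auto simp: closed_segment_eq_real_ivl split: if_splits)
    then have cb: "0 \<le> cos a" "cos a \<le> cos b"
      using a(2) by (auto intro!: cos_mono_abs cos_ge_zero)
    define l where "l = (if cos b = 0 then 0 else cos a / cos b)"
    have l: "0 \<le> l" "l \<le> 1" "cos a = l * cos b" using cb by (auto simp: l_def)
    then have "cos (real n * \<theta>) = l * cos (real n * \<phi>)"
      unfolding a(1) b(1) cos_add_int_pi by simp
    then show ?thesis
      using quadratic_pos[OF v(1) l(1,2)] W_polar[OF v(1)] Wv by simp
  qed
  have 1: "connected_component S v (polar t \<theta>')"
    unfolding v(2) by (rule link_angle) (use W_seg in force)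
  define \<sigma> where "\<sigma> = cos (of_int m * pi)"
  have \<sigma>: "\<sigma> \<in> {1, -1}" unfolding \<sigma>_def by (rule cos_int_pi_cases)
  have "G \<sigma> t > 0" using W_seg[of \<theta>'] W_central[OF v(1), of m] by (simp add: \<theta>'_def \<sigma>_def)
  then obtain i where i: "i \<le> k" "\<forall>x\<in>closed_segment t (s i). G \<sigma> x > 0"
    using s_link[OF t \<sigma>] by blast
  have 2: "connected_component S (polar t \<theta>') (polar (s i) \<theta>')"
  proof (rule link_ray)
    fix x assume x: "x \<in> closed_segment t (s i)"
    then have "x \<ge> 0" using t s_gt_0[OF i(1)] by (auto simp: closed_segment_eq_real_ivl split: if_splits)
    then show "W (polar x \<theta>') \<noteq> 0"
      using i(2) x W_central[of x m] by (auto simp: \<theta>'_def \<sigma>_def)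
  qed
  have "(-1) ^ i * \<sigma> * G \<sigma> (s i) > 0" "G \<sigma> (s i) > 0"
    using s_sign[OF i(1) \<sigma>] i(2) by auto
  then have "(-1) ^ i * \<sigma> > 0" by (simp add: zero_less_mult_iff)
  then have par: "even m \<longleftrightarrow> even i"
    unfolding \<sigma>_def cos_int_pi by (cases "even i"; cases "even m") auto
  \<comment> \<open>Rays repeat after a full turn, that is, after \<open>2 * n\<close> steps; since
    this number is even, the parity survives the reduction.\<close>
  define j where "j = nat (m mod (2 * int n))"
  have j: "int j = m mod (2 * int n)" "j < 2 * n" using n by (auto simp: j_def nat_less_iff)
  have "even j \<longleftrightarrow> even m"
    using j(1) by (metis dvd_mod_iff dvd_triv_left even_of_nat)
  then have "j mod 2 = i mod 2" using par by (metis even_iff_mod_2_eq_zero mod2_eq_if)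
  then have jl: "j = 2 * (j div 2) + i mod 2" by presburger
  obtain d where d: "m = int j + d * (2 * int n)" using j(1) by (metis mod_div_mult_eq add.commute)
  have "of_int m * pi / real n = real j * pi / real n + of_int d * (2 * pi)"
    using n by (simp add: d field_simps)
  then have "polar (s i) \<theta>' = polar (s i) (real j * pi / real n)"
    unfolding \<theta>'_def
    by (intro polar_cong) (simp_all add: cos_add sin_add cos_int_2pin sin_int_2pin mult.commute[of _ "2 * pi"])
  also have "\<dots> = rep i (j div 2)" unfolding rep_def using jl by metis
  finally have "connected_component S v (rep i (j div 2))"
    using connected_component_trans[OF 1 2] by simp
  moreover have "j div 2 < n" using j(2) by simp
  ultimately show thesis using that i(1) by blast
qed

lemma W_rep:
  assumes "i \<le> k"
  shows "W (rep i l) > 0"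
proof -
  let ?m = "int (2 * l + i mod 2)"
  have "even ?m \<longleftrightarrow> even i" by simp
  then have "cos (of_int ?m * pi) = (-1) ^ i" unfolding cos_int_pi by simp
  moreover have "W (rep i l) = G (cos (of_int ?m * pi)) (s i)"
    using W_central[OF less_imp_le[OF s_gt_0[OF assms]], of ?m] unfolding rep_def by simp
  moreover have "(-1) ^ i * (-1) ^ i = (1::real)" by (simp flip: power_add mult_2)
  ultimately show ?thesis using s_sign[OF assms, of "(-1) ^ i"] by (cases "even i") auto
qed

text \<open>The zero set of \<open>Re z\<^sup>n\<close> is a union of lines through the origin.  None of them meets a
  connected set on which \<open>W > 0\<close>, so such a set lies on one side of each line, that is, in a
  single sector.\<close>

lemma rays_separated:
  assumes T: "connected T" "\<And>v. v \<in> T \<Longrightarrow> W v > 0"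
    and "polar t (real j * pi / real n) \<in> T" "polar t' (real j' * pi / real n) \<in> T"
    and "t > 0" "t' > 0" "j < j'" "j' < 2 * n"
  shows False
proof -
  define line where "line \<alpha> v = v $ 2 * cos \<alpha> - v $ 1 * sin \<alpha>" for \<alpha> and v :: "real ^ 2"
  have line_polar: "line \<alpha> (polar x \<theta>) = sqrt x * sin (\<theta> - \<alpha>)" for \<alpha> x \<theta>
    by (simp add: line_def sin_diff algebra_simps)
  have nz: "line \<alpha> v \<noteq> 0" if \<alpha>: "cos (real n * \<alpha>) = 0" and "v \<in> T" for \<alpha> v
  proof
    assume zero: "line \<alpha> v = 0"
    obtain x \<theta> where v: "x \<ge> 0" "v = polar x \<theta>" by (rule polar_exists)
    have "x \<noteq> 0" using T(2)[OF \<open>v \<in> T\<close>] v W_zero by auto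
    then have "sin (\<theta> - \<alpha>) = 0" using zero v by (simp add: line_polar)
    then obtain i where "\<theta> - \<alpha> = of_int i * pi" by (auto simp: sin_zero_iff_int2)
    then have "real n * \<theta> = of_int (int n * i) * pi + real n * \<alpha>" by (simp add: algebra_simps)
    then have "cos (real n * \<theta>) = 0" by (simp only: cos_add_int_pi \<alpha> mult_zero_right)
    then have "W v = A x" using v by (simp add: W_polar)
    then show False using A_neg[OF v(1)] T(2)[OF \<open>v \<in> T\<close>] by simp
  qed
  have same: "line \<alpha> v > 0 \<longleftrightarrow> line \<alpha> w > 0"
    if "cos (real n * \<alpha>) = 0" "v \<in> T" "w \<in> T" for \<alpha> v w
  proof -
    have "continuous_on T (line \<alpha>)" unfolding line_def by (intro continuous_intros)
    then show ?thesis
      using connected_no_zero_same_sign[of T "line \<alpha>" v w]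
        connected_no_zero_same_sign[of T "line \<alpha>" w v] T(1) nz[OF that(1)] that(2,3) by blast
  qed
  define h where "h = pi / real n"
  have h: "h > 0" "real n * h = pi" using n by (simp_all add: h_def)
  have small: "h / 2 < pi" using h n mult_right_mono[of 1 "real n" h] by simp
  define p p' where "p = polar t (real j * pi / real n)" and "p' = polar t' (real j' * pi / real n)"
  have p: "line \<alpha> p = sqrt t * sin (real j * h - \<alpha>)" "line \<alpha> p' = sqrt t' * sin (real j' * h - \<alpha>)" for \<alpha>
    by (simp_all add: p_def p'_def line_polar h_def)
  have in_T: "p \<in> T" "p' \<in> T" using assms by (simp_all add: p_def p'_def)
  have hn: "real m * h \<le> pi" if "m \<le> n" for m
    using mult_right_mono[of "real m" "real n" h] that h by simp
  show False
  \<comment> \<open>If ray \<open>j'\<close> is at most half a turn ahead, the line half a step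
    after ray \<open>j\<close> separates the two rays; otherwise the line half a step before ray
    \<open>j\<close> does.\<close>
  proof (cases "j' - j \<le> n")
    case True
    define \<alpha> where "\<alpha> = real j * h + h / 2"
    have "real n * \<alpha> = of_int (int j) * pi + pi / 2"
      by (simp add: \<alpha>_def distrib_left mult.left_commute h(2))
    then have "cos (real n * \<alpha>) = 0" by (simp only: cos_add_int_pi) simp
    moreover have "sin (real j * h - \<alpha>) < 0"
      using sin_gt_zero[of "h / 2"] h(1) small by (simp add: \<alpha>_def)
    then have "\<not> line \<alpha> p > 0" using assms(5) by (simp add: p mult_pos_neg not_less mult_nonneg_nonpos)
    moreover have "sin (real j' * h - \<alpha>) > 0"
    proof (rule sin_gt_zero)
      have e: "real j' * h - \<alpha> = real (j' - j) * h - h / 2"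
        using assms(7) by (simp add: \<alpha>_def of_nat_diff algebra_simps)
      have "h \<le> real (j' - j) * h" using assms(7) h(1) by simp
      then show "0 < real j' * h - \<alpha>" unfolding e using h(1) by linarith
      show "real j' * h - \<alpha> < pi" unfolding e using hn[OF True] h(1) by linarith
    qed
    then have "line \<alpha> p' > 0" using assms(6) by (simp add: p)
    ultimately show False using same in_T by blast
  next
    case False
    define \<alpha> where "\<alpha> = real j * h - h / 2"
    have "real n * \<alpha> = of_int (int j) * pi + - (pi / 2)"
      by (simp add: \<alpha>_def right_diff_distrib mult.left_commute h(2))
    then have "cos (real n * \<alpha>) = 0" by (simp only: cos_add_int_pi) simp
    moreover have "sin (real j * h - \<alpha>) > 0"
      using sin_gt_zero[of "h / 2"] h(1) small by (simp add: \<alpha>_def)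
    then have "line \<alpha> p > 0" using assms(5) by (simp add: p)
    moreover have "sin (real j' * h - \<alpha>) < 0"
    proof (rule sin_lt_zero)
      have e: "real j' * h - \<alpha> = real (j' - j) * h + h / 2"
        using assms(7) by (simp add: \<alpha>_def of_nat_diff algebra_simps)
      have "real n * h \<le> real (j' - j) * h" using False h(1) by (intro mult_right_mono) auto
      then show "pi < real j' * h - \<alpha>" unfolding e using h by linarith
      have "real (j' - j) * h \<le> (2 * real n - 1) * h"
        using assms(7,8) h(1) by (intro mult_right_mono) (auto simp: of_nat_diff)
      also have "\<dots> = 2 * pi - h" using h(2) by (simp add: algebra_simps)
      finally show "real j' * h - \<alpha> < 2 * pi" unfolding e using h(1) by linarith
    qed
    then have "\<not> line \<alpha> p' > 0" using assms(6) by (simp add: p mult_pos_neg not_less mult_nonneg_nonpos)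
    ultimately show False using same in_T by blast
  qed
qed

text \<open>On a connected set with \<open>W > 0\<close> the sign of \<open>Re (z ^ n)\<close> is
  constant, here that of \<open>\<sigma> = (-1) ^ i\<close>. By equal parity
  \<open>i' > i + 1\<close>, so the set crosses the circle \<open>t = s (Suc i)\<close>. There the
  value at cosine \<open>\<sigma>\<close> is negative, hence by \<open>quadratic_neg\<close> so is
  \<open>W\<close> wherever the cosine has the sign of \<open>\<sigma>\<close>.\<close>

lemma circles_separated:
  assumes T: "connected T" "\<And>v. v \<in> T \<Longrightarrow> W v > 0"
    and ij: "i < i'" "i' \<le> k" "even i \<longleftrightarrow> even i'" and "rep i l \<in> T" "rep i' l' \<in> T"
  shows False
proof -
  define \<sigma> :: real where "\<sigma> = (-1) ^ i"
  define q where "q v = Re (to_complex v ^ n)" for v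
  have q_polar: "q (polar t \<theta>) = sqrt t ^ n * cos (real n * \<theta>)" for t \<theta>
    by (simp add: q_def to_complex_polar DeMoivre2)
  have q_cont: "continuous_on T (\<lambda>v. \<sigma> * q v)"
    unfolding q_def by (intro continuous_intros)
  have \<sigma>: "\<sigma> \<in> {1, -1}" by (cases "even i") (simp_all add: \<sigma>_def)
  have q_nz: "\<sigma> * q v \<noteq> 0" if "v \<in> T" for v
  proof
    assume "\<sigma> * q v = 0"
    obtain x \<theta> where v: "x \<ge> 0" "v = polar x \<theta>" by (rule polar_exists)
    have "x \<noteq> 0" using T(2)[OF that] v W_zero by auto
    then have "cos (real n * \<theta>) = 0" using \<open>\<sigma> * q v = 0\<close> v \<sigma> by (auto simp: q_polar)
    then have "W v = A x" using v by (simp add: W_polar)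
    then show False using A_neg[OF v(1)] T(2)[OF that] by simp
  qed
  have i: "i \<le> k" "Suc i \<le> k" "Suc i < i'"
  proof -
    have "Suc i \<noteq> i'" using ij(3) by auto
    then show "i \<le> k" "Suc i \<le> k" "Suc i < i'" using ij by linarith+
  qed
  have "\<sigma> * q (rep i l) > 0"
  proof -
    let ?m = "int (2 * l + i mod 2)"
    have "even ?m \<longleftrightarrow> even i" by simp
    then have "cos (of_int ?m * pi) = \<sigma>" unfolding cos_int_pi \<sigma>_def by simp
    then have "q (rep i l) = sqrt (s i) ^ n * \<sigma>"
      using n unfolding rep_def q_polar by simp
    then show ?thesis using \<sigma> s_gt_0[OF i(1)] by auto
  qed
  then have q_pos: "\<sigma> * q v > 0" if "v \<in> T" for v
    using connected_no_zero_same_sign[OF T(1) q_cont q_nz assms(6) that] by simp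
  have "\<exists>v\<in>T. (norm v)\<^sup>2 = s (Suc i)"
  proof -
    have "continuous_on T (\<lambda>v. (norm v)\<^sup>2)" by (intro continuous_intros)
    from connected_continuous_image[OF this T(1)]
    have "connected ((\<lambda>v. (norm v)\<^sup>2) ` T)" .
    moreover have "(norm (rep i l))\<^sup>2 = s i" "(norm (rep i' l'))\<^sup>2 = s i'"
      using s_gt_0[of i] s_gt_0[of i'] i ij by (simp_all add: rep_def norm_polar_squared)
    moreover have "s i \<le> s (Suc i)" "s (Suc i) \<le> s i'"
      using i ij by (auto intro!: strict_mono_on_leD[OF s_mono])
    ultimately have "s (Suc i) \<in> (\<lambda>v. (norm v)\<^sup>2) ` T"
      using connectedD_interval[of "(\<lambda>v. (norm v)\<^sup>2) ` T" "s i" "s i'" "s (Suc i)"] assms(6,7)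
      by (metis imageI)
    then show ?thesis by force
  qed
  then obtain v where v: "v \<in> T" "(norm v)\<^sup>2 = s (Suc i)" by blast
  obtain t \<theta> where t: "t \<ge> 0" "v = polar t \<theta>" by (rule polar_exists)
  have ts: "t = s (Suc i)" using v(2) t by (simp add: norm_polar_squared)
  have "\<sigma> * (sqrt t ^ n * cos (real n * \<theta>)) > 0" using q_pos[OF v(1)] t by (simp add: q_polar)
  then have "sqrt t ^ n * (\<sigma> * cos (real n * \<theta>)) > 0" by (simp only: mult.left_commute)
  moreover have "sqrt t ^ n > 0" using s_gt_0[OF i(2)] by (simp add: ts)
  ultimately have "\<sigma> * cos (real n * \<theta>) > 0" by (rule zero_less_mult_pos)
  define l where "l = \<sigma> * cos (real n * \<theta>)"
  have l: "0 \<le> l" "l \<le> 1" "cos (real n * \<theta>) = l * \<sigma>"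
    using \<open>\<sigma> * cos (real n * \<theta>) > 0\<close> \<sigma> cos_le_one[of "real n * \<theta>"] cos_ge_minus_one[of "real n * \<theta>"]
    by (auto simp: l_def)
  have "(-1) ^ Suc i * \<sigma> * G \<sigma> t > 0" using s_sign[OF i(2) \<sigma>] ts by simp
  moreover have "(-1) ^ Suc i * \<sigma> = -1" by (simp add: \<sigma>_def flip: power_add mult_2)
  ultimately have "A t + B t * \<sigma> + C t * \<sigma>\<^sup>2 < 0" using \<sigma> by (auto simp: mult.commute)
  then have "W v < 0"
    using quadratic_neg[OF t(1) l(1,2), of \<sigma>] unfolding t(2) W_polar[OF t(1)] l(3) by simp
  then show False using T(2)[OF v(1)] by simp
qed

text \<open>\<open>rays_separated\<close> makes the ray indices \<open>2 * l + i mod 2\<close>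
  equal, which fixes \<open>l\<close> and the parity of \<open>i\<close>;
  \<open>circles_separated\<close> then fixes \<open>i\<close>.\<close>

lemma reps_inequivalent:
  assumes "connected_component S (rep i l) (rep i' l')" "i \<le> k" "i' \<le> k" "l < n" "l' < n"
  shows "i = i' \<and> l = l'"
proof -
  obtain T where T: "connected T" "T \<subseteq> S" "rep i l \<in> T" "rep i' l' \<in> T"
    using assms(1) unfolding connected_component_def by blast
  have pos: "W v > 0" if "v \<in> T" for v
    using connected_no_zero_same_sign[OF T(1) continuous_on_subset[OF W_cont] _ T(3) that W_rep[OF assms(2)]] T(2)
    by (auto simp: S_def)
  let ?j = "2 * l + i mod 2" and ?j' = "2 * l' + i' mod 2"
  have "i mod 2 < 2" "i' mod 2 < 2" by simp_all
  then have j: "?j < 2 * n" "?j' < 2 * n" using assms(4,5) by linarith+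
  have "?j = ?j'"
    using rays_separated[OF T(1) pos T(3,4)[unfolded rep_def]]
      rays_separated[OF T(1) pos T(4,3)[unfolded rep_def]] j s_gt_0 assms(2,3)
    by (metis linorder_neqE_nat)
  then have "i mod 2 = i' mod 2" by presburger
  moreover have "i = i'"
    using circles_separated[OF T(1) pos, of i i' l l'] circles_separated[OF T(1) pos, of i' i l' l]
      T assms(2,3) \<open>i mod 2 = i' mod 2\<close>
    by (metis even_iff_mod_2_eq_zero linorder_neqE_nat)
  ultimately show ?thesis using \<open>?j = ?j'\<close> by simp
qed

text \<open>The summand 1 is the component of the origin, which contains every point with
  \<open>W < 0\<close>; the other components correspond to the points
  \<open>rep i l\<close>.\<close>

lemma card_components: "card (components {v. W v \<noteq> 0}) = 1 + (k + 1) * n"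
proof -
  define comp where "comp = connected_component_set S"
  let ?I = "{..k} \<times> {..<n}"
  have repS: "rep i l \<in> S" if "i \<le> k" for i l using W_rep[OF that, of l] by (simp add: S_def)
  have zeroS: "0 \<in> S" using W_zero by (auto simp: S_def)
  have "components S = insert (comp 0) ((\<lambda>(i, l). comp (rep i l)) ` ?I)"
  proof (intro equalityI subsetI)
    fix K assume "K \<in> components S"
    then obtain v where v: "v \<in> S" "K = comp v" by (auto simp: components_def comp_def)
    show "K \<in> insert (comp 0) ((\<lambda>(i, l). comp (rep i l)) ` ?I)"
    proof (cases "W v > 0")
      case True
      then obtain i l where "i \<le> k" "l < n" "connected_component S v (rep i l)"
        by (rule positive_linked_to_rep)
      then have "K = comp (rep i l)" using v by (simp add: comp_def connected_component_eq)
      then show ?thesis using \<open>i \<le> k\<close> \<open>l < n\<close> by force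
    next
      case False
      then have "W v < 0" using v by (simp add: S_def)
      then have "K = comp 0" using v negative_linked_to_0[of v] by (simp add: comp_def connected_component_eq)
      then show ?thesis by simp
    qed
  next
    fix K assume "K \<in> insert (comp 0) ((\<lambda>(i, l). comp (rep i l)) ` ?I)"
    then show "K \<in> components S" using zeroS repS by (auto simp: components_def comp_def)
  qed
  moreover have "inj_on (\<lambda>(i, l). comp (rep i l)) ?I"
    using repS reps_inequivalent
    by (auto simp: inj_on_def comp_def connected_component_eq_eq)
  moreover have "comp 0 \<notin> (\<lambda>(i, l). comp (rep i l)) ` ?I"
  proof
    assume "comp 0 \<in> (\<lambda>(i, l). comp (rep i l)) ` ?I"
    then obtain i l where "i \<le> k" "connected_component S 0 (rep i l)"
      using zeroS repS by (auto simp: comp_def connected_component_eq_eq)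
    then obtain T where T: "connected T" "T \<subseteq> S" "0 \<in> T" "rep i l \<in> T"
      unfolding connected_component_def by blast
    then have "W 0 > 0"
      using connected_no_zero_same_sign[OF T(1) continuous_on_subset[OF W_cont] _ T(4,3) W_rep[OF \<open>i \<le> k\<close>]]
      by (auto simp: S_def)
    then show False using W_zero by simp
  qed
  ultimately show ?thesis
    by (simp add: S_def[symmetric] card_image card_cartesian_product)
qed

text \<open>The angular derivative vanishes only if \<open>B + 2 * C * c = 0\<close> or the sine is
  0. In the first case \<open>W = 0\<close> gives \<open>A = C * c\<^sup>2\<close>, against
  \<open>A < 0\<close>. In the second the point lies on a ray where the zeros in \<open>t\<close>
  are simple.\<close>

lemma no_critical_zero:
  assumes C_pos: "\<And>t. t > 0 \<Longrightarrow> C t > 0"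
    and regular: "\<And>t \<sigma>. t > 0 \<Longrightarrow> \<sigma> \<in> {1, -1} \<Longrightarrow> G \<sigma> t = 0 \<Longrightarrow>
      \<exists>D. D \<noteq> 0 \<and> (G \<sigma> has_real_derivative D) (at t)"
  shows "\<not> critical_zero W v"
proof
  assume "critical_zero W v"
  then have W0: "W v = 0" and dW: "(W has_derivative (\<lambda>_. 0)) (at v)"
    by (simp_all add: critical_zero_def)
  obtain t \<theta> where v: "t \<ge> 0" "v = polar t \<theta>" by (rule polar_exists)
  have "t \<noteq> 0" using W0 v W_zero by auto
  with v have t: "t > 0" by simp
  let ?c = "cos (real n * \<theta>)" and ?s = "sin (real n * \<theta>)"
  have chain: "((\<lambda>x. W (\<gamma> x)) has_real_derivative 0) (at x)"
    if "(\<gamma> has_derivative \<gamma>') (at x)" "\<gamma> x = v" for \<gamma> \<gamma>' x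
    using has_derivative_compose[OF that(1), of W "\<lambda>_. 0"] dW that(2)
    by (simp add: has_field_derivative_def flip: lambda_zero)
  have "((\<lambda>\<phi>. W (polar t \<phi>)) has_real_derivative 0) (at \<theta>)"
    by (rule chain[of _ "\<lambda>h. sqrt t *\<^sub>R ((h * - sin \<theta>) *\<^sub>R axis 1 1 + (h * cos \<theta>) *\<^sub>R axis 2 1)"])
      (auto simp: polar_def[abs_def] v(2) intro!: derivative_eq_intros)
  moreover have "((\<lambda>\<phi>. W (polar t \<phi>)) has_real_derivative - (B t + 2 * C t * ?c) * (real n * ?s)) (at \<theta>)"
    unfolding W_polar[OF v(1)] by (auto intro!: derivative_eq_intros simp: algebra_simps)
  ultimately have "(B t + 2 * C t * ?c) * (real n * ?s) = 0" using DERIV_unique by fastforce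
  then consider "B t + 2 * C t * ?c = 0" | "?s = 0" using n by auto
  then show False
  proof cases
    case 1
    then have "B t = - 2 * C t * ?c" by simp
    moreover have "A t + B t * ?c + C t * ?c\<^sup>2 = 0" using W0 v W_polar by simp
    ultimately have "A t = C t * ?c\<^sup>2" by (simp add: power2_eq_square algebra_simps)
    then show False using A_neg[OF v(1)] C_nonneg[OF v(1)] by (metis mult_nonneg_nonneg not_less zero_le_power2)
  next
    case 2
    then have "?c\<^sup>2 = 1" using sin_cos_squared_add[of "real n * \<theta>"] by simp
    then have c: "?c \<in> {1, -1}" by (simp add: power2_eq_1_iff)
    have W_ray: "W (polar x \<theta>) = G ?c x" if "x > 0" for x
      using W_polar[of x \<theta>] that \<open>?c\<^sup>2 = 1\<close> by simp
    then have "G ?c t = 0" using W0 v t by simp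
    then obtain D where D: "D \<noteq> 0" "(G ?c has_real_derivative D) (at t)"
      using regular[OF t c] by blast
    have "((\<lambda>x. W (polar x \<theta>)) has_real_derivative 0) (at t)"
      by (rule chain[of _ "\<lambda>h. (h * (inverse (sqrt t) / 2)) *\<^sub>R (cos \<theta> *\<^sub>R axis 1 1 + sin \<theta> *\<^sub>R axis 2 1)"])
        (use t in \<open>auto simp: polar_def[abs_def] v(2) intro!: derivative_eq_intros\<close>)
    then have "(G ?c has_real_derivative 0) (at t)"
      by (rule has_field_derivative_transform_within_open[where S = "{0<..}"]) (use t W_ray in auto)
    then show False using DERIV_unique[OF D(2)] D(1) by blast
  qed
qed

end

section \<open>The eigenfunctions and the asymptotics of their nodal counts\<close>

lemma oscillator_eigenfunction_exists:
  assumes "k \<ge> 1"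
  shows "\<exists>u. is_eigenfunction (oscillator_eigenvalue (4 * k)) u \<and> (\<nexists>x. critical_zero u x) \<and>
     nodal_count u = 1 + (k + 1) * (2 * k)"
proof -
  define L where "L = laguerre k (2 * k)"
  define M where "M = laguerre (2 * k) 0"
  obtain z where z: "L = (\<Prod>i<k. [:z i, -1:])" "strict_mono_on {..<k} z"
    "\<And>i. i < k \<Longrightarrow> z i > 0"
    using laguerre_factorization[of k "2 * k"] unfolding L_def by blast
  have M0: "poly M 0 > 0" unfolding M_def by (rule poly_laguerre_0_pos)
  moreover have "poly (pderiv M) 0 = - (2 * real k * poly M 0)"
    using poly_laguerre_ode[of 0 "2 * k" 0] by (simp add: M_def)
  moreover have "degree M \<le> 2 * k" unfolding M_def by (rule degree_laguerre)
  ultimately interpret perturbed_ray k z L M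
    using assms z by unfold_locales auto
  show ?thesis
  proof (rule perturbation)
    fix \<epsilon> \<delta> s
    assume \<epsilon>: "\<epsilon> > 0" and \<delta>: "\<delta> > 0"
      and A: "\<And>t. t \<ge> 0 \<Longrightarrow> \<epsilon> * t ^ (2 * k) + \<delta> * poly M t > 0"
      and s: "strict_mono_on {..k} s" "s 0 > 0"
      and sign: "\<And>i \<sigma>. i \<le> k \<Longrightarrow> \<sigma> \<in> {1, -1} \<Longrightarrow>
         (-1) ^ i * \<sigma> * poly (ray_poly k L M \<epsilon> \<delta> \<sigma>) (s i) > 0"
      and regular: "\<And>t \<sigma>. t > 0 \<Longrightarrow> \<sigma> \<in> {1, -1} \<Longrightarrow> poly (ray_poly k L M \<epsilon> \<delta> \<sigma>) t = 0 \<Longrightarrow>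
         poly (pderiv (ray_poly k L M \<epsilon> \<delta> \<sigma>)) t \<noteq> 0"
      and link: "\<And>t \<sigma>. t > 0 \<Longrightarrow> \<sigma> \<in> {1, -1} \<Longrightarrow> poly (ray_poly k L M \<epsilon> \<delta> \<sigma>) t > 0 \<Longrightarrow>
         \<exists>i\<le>k. \<forall>x\<in>closed_segment t (s i). poly (ray_poly k L M \<epsilon> \<delta> \<sigma>) x > 0"
    define W where "W v = poly L ((norm v)\<^sup>2) * Re (to_complex v ^ (2 * k))
       + \<epsilon> * Re (to_complex v ^ (4 * k)) - \<delta> * poly M ((norm v)\<^sup>2)" for v
    define u where "u v = exp (- (norm v)\<^sup>2 / 2) * W v" for v
    \<comment> \<open>With \<open>c = cos (2 * k * \<theta>)\<close>, the identity
      \<open>cos (4 * k * \<theta>) = 2 * c\<^sup>2 - 1\<close> splits the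
      \<open>\<epsilon>\<close>-term between the constant and the quadratic coefficient;
      \<open>A\<close> then says that the constant one is negative.\<close>
    define a where "a t = - (\<epsilon> * t ^ (2 * k) + \<delta> * poly M t)" for t
    define b where "b t = t ^ k * poly L t" for t
    define c where "c t = 2 * \<epsilon> * t ^ (2 * k)" for t
    have G: "a t + \<sigma> * b t + c t = poly (ray_poly k L M \<epsilon> \<delta> \<sigma>) t" for t \<sigma>
      by (simp add: a_def b_def c_def poly_ray_poly)
    interpret polar_quadratic "2 * k" k W a b c s
    proof
      show "continuous_on UNIV W"
        unfolding W_def by (intro continuous_intros)
    next
      fix t \<theta> :: real assume t: "t \<ge> 0"
      have pow: "Re (to_complex (polar t \<theta>) ^ (2 * j)) = t ^ j * cos (real (2 * j) * \<theta>)" for j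
      proof -
        have "sqrt t ^ (2 * j) = t ^ j" using t by (simp add: power_mult)
        then show ?thesis by (simp only: to_complex_polar DeMoivre2 Re_rcis)
      qed
      have "cos (real (2 * (2 * k)) * \<theta>) = 2 * (cos (real (2 * k) * \<theta>))\<^sup>2 - 1"
        using cos_double_cos[of "real (2 * k) * \<theta>"] by (simp add: mult_ac)
      then have pow2: "Re (to_complex (polar t \<theta>) ^ (4 * k)) = t ^ (2 * k) * (2 * (cos (real (2 * k) * \<theta>))\<^sup>2 - 1)"
        using pow[of "2 * k"] by (simp only: mult.assoc[symmetric]) simp
      show "W (polar t \<theta>) = a t + b t * cos (real (2 * k) * \<theta>) + c t * (cos (real (2 * k) * \<theta>))\<^sup>2"
        unfolding W_def pow pow2 norm_polar_squared[OF t] a_def b_def c_def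
        by (simp add: algebra_simps del: of_nat_mult)
      show "a t < 0" using A[OF t] by (simp add: a_def)
      show "c t \<ge> 0" using \<epsilon> t by (simp add: c_def)
    next
      show "1 \<le> 2 * k" using assms by simp
      show "(-1) ^ i * \<sigma> * (a (s i) + \<sigma> * b (s i) + c (s i)) > 0"
        if "i \<le> k" "\<sigma> \<in> {1, -1}" for i \<sigma>
        unfolding G using that by (rule sign)
      show "\<exists>i\<le>k. \<forall>x\<in>closed_segment t (s i). a x + \<sigma> * b x + c x > 0"
        if "t > 0" "\<sigma> \<in> {1, -1}" "a t + \<sigma> * b t + c t > 0" for t \<sigma>
        using that unfolding G by (rule link)
    qed (rule s)+
    have "is_eigenfunction (oscillator_eigenvalue (4 * k)) u"
    proof (rule oscillator_mode_eigenfunction)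
      have ev: "oscillator_eigenvalue (4 * k) = 2 * (real (4 * k) + 1)"
        by (simp add: oscillator_eigenvalue_def)
      \<comment> \<open>The pairs of radial degree and angular order are \<open>(k, 2 * k)\<close>,
        \<open>(0, 4 * k)\<close> and \<open>(2 * k, 0)\<close>; all have level
        \<open>2 * n + m = 4 * k\<close>.\<close>
      have modes: "oscillator_mode (oscillator_eigenvalue (4 * k))
           (\<lambda>v. poly L ((norm v)\<^sup>2) * exp (- (norm v)\<^sup>2 / 2) * Re (to_complex v ^ (2 * k)))"
        "oscillator_mode (oscillator_eigenvalue (4 * k))
           (\<lambda>v. poly 1 ((norm v)\<^sup>2) * exp (- (norm v)\<^sup>2 / 2) * Re (to_complex v ^ (4 * k)))"
        "oscillator_mode (oscillator_eigenvalue (4 * k))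
           (\<lambda>v. poly M ((norm v)\<^sup>2) * exp (- (norm v)\<^sup>2 / 2) * Re (to_complex v ^ 0))"
        using polar_mode[of L "2 * k" k] poly_laguerre_ode[of _ k "2 * k"]
          polar_mode[of 1 "4 * k" 0]
          polar_mode[of M 0 "2 * k"] poly_laguerre_ode[of _ "2 * k" 0]
        by (simp_all add: ev L_def M_def)
      have "u = (\<lambda>v. 1 * (1 * (poly L ((norm v)\<^sup>2) * exp (- (norm v)\<^sup>2 / 2) * Re (to_complex v ^ (2 * k)))
           + \<epsilon> * (poly 1 ((norm v)\<^sup>2) * exp (- (norm v)\<^sup>2 / 2) * Re (to_complex v ^ (4 * k))))
           + (- \<delta>) * (poly M ((norm v)\<^sup>2) * exp (- (norm v)\<^sup>2 / 2) * Re (to_complex v ^ 0)))"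
        by (simp add: fun_eq_iff u_def W_def algebra_simps)
      then show "oscillator_mode (oscillator_eigenvalue (4 * k)) u"
        by (simp only: oscillator_mode_linear_combination modes)
      show "u 0 \<noteq> 0" using W_zero by (simp add: u_def)
    qed
    moreover have "\<not> critical_zero u x" for x
    proof
      assume "critical_zero u x"
      then have ux: "u x = 0" "(u has_derivative (\<lambda>_. 0)) (at x)" by (simp_all add: critical_zero_def)
      \<comment> \<open>Multiplying by the inverse Gaussian recovers \<open>W\<close>; at a critical
        zero of \<open>u\<close> both terms of the product rule vanish.\<close>
      have "((\<lambda>v. exp ((v \<bullet> v) / 2)) has_derivative (\<lambda>h. exp ((x \<bullet> x) / 2) * (x \<bullet> h))) (at x)"
        by (auto intro!: derivative_eq_intros simp: inner_commute)
      from has_derivative_mult[OF this ux(2)]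
      have "((\<lambda>v. exp ((v \<bullet> v) / 2) * u v) has_derivative (\<lambda>_. 0)) (at x)" using ux(1) by simp
      moreover have "(\<lambda>v. exp ((v \<bullet> v) / 2) * u v) = W"
        by (simp add: fun_eq_iff u_def power2_norm_eq_inner flip: mult.assoc exp_add)
      ultimately have "critical_zero W x" using ux(1) by (simp add: critical_zero_def u_def)
      moreover have "\<not> critical_zero W x"
      proof (rule no_critical_zero)
        fix t :: real assume "t > 0"
        then show "c t > 0" using \<epsilon> by (simp add: c_def)
      next
        fix t \<sigma> :: real assume *: "t > 0" "\<sigma> \<in> {1, -1}" "a t + \<sigma> * b t + c t = 0"
        show "\<exists>D. D \<noteq> 0 \<and> ((\<lambda>t. a t + \<sigma> * b t + c t) has_real_derivative D) (at t)"
          unfolding G using regular[OF *(1,2)] *(3) poly_DERIV by (metis G)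
      qed
      ultimately show False by blast
    qed
    moreover have "nodal_count u = 1 + (k + 1) * (2 * k)"
    proof -
      have zero_iff: "u v = 0 \<longleftrightarrow> W v = 0" for v by (simp add: u_def)
      have "closed {v. W v = 0}" using W_cont by (intro closed_Collect_eq) auto
      then have "UNIV - nodal_set u = {v. W v \<noteq> 0}"
        by (auto simp: nodal_set_def zero_iff)
      then show ?thesis using card_components by (simp add: nodal_count_def nodal_domains_def)
    qed
    ultimately show ?thesis by blast
  qed
qed

theorem theorem1p6:
  "\<exists>u :: nat \<Rightarrow> real^2 \<Rightarrow> real.
     (\<forall>k\<ge>1. is_eigenfunction (oscillator_eigenvalue (4 * k)) (u k) \<and>
             (\<nexists>x. critical_zero (u k) x)) \<and>
     (\<lambda>k. real (nodal_count (u k))) \<sim>[sequentially] (\<lambda>k. (4 * real k)\<^sup>2 / 8)"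
proof -
  obtain u where u: "\<And>k. k \<ge> 1 \<Longrightarrow> is_eigenfunction (oscillator_eigenvalue (4 * k)) (u k) \<and>
      (\<nexists>x. critical_zero (u k) x) \<and> nodal_count (u k) = 1 + (k + 1) * (2 * k)"
    using oscillator_eigenfunction_exists by metis
  \<comment> \<open>Both sides have leading term \<open>2 * k\<^sup>2\<close>.\<close>
  have "(\<lambda>k. real (1 + (k + 1) * (2 * k))) \<sim>[sequentially] (\<lambda>k. (4 * real k)\<^sup>2 / 8)"
    unfolding of_nat_add of_nat_mult by real_asymp
  \<comment> \<open>Nothing is known about \<open>u 0\<close>, so the counts are compared only from
    \<open>k = 1\<close> on.\<close>
  moreover have "eventually (\<lambda>k. real (1 + (k + 1) * (2 * k)) = real (nodal_count (u k))) sequentially"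
    using eventually_ge_at_top[of 1] by eventually_elim (simp add: u)
  ultimately have "(\<lambda>k. real (nodal_count (u k))) \<sim>[sequentially] (\<lambda>k. (4 * real k)\<^sup>2 / 8)"
    using asymp_equiv_cong by (smt (verit) eventually_mono)
  then show ?thesis using u by blast
qed

end
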